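(* Let $f$ be any nonconstant holomorphic solution of the $\mathbb{C}P^{N-1}$ sigma model (defined on $S^2$ with finite action), and for $k\le N-1$ let $$\mathcal{P}_k=\frac{V_k\otimes V_k^\dagger}{V_k^\dagger\cdot V_k},\qquad V_k=P_+^kf,$$ be the associated rank-one projectors. For the projector $\mathcal{P}_k$ the generalized Weierstrass data $dX=i\left(-[\partial\mathcal{P}_k,\mathcal{P}_k]\,d\xi+[\bar\partial\mathcal{P}_k,\mathcal{P}_k]\,d\bar\xi\right)$ become $$dX=-i\left[\left(\partial\mathcal{P}_k+2\,\frac{(P_+^kf)\otimes(P_+^{k-1}f)^\dagger}{|P_+^{k-1}f|^2}\right)d\xi+\left(\bar\partial\mathcal{P}_k+2\,\frac{(P_+^{k-1}f)\otimes(P_+^{k}f)^\dagger}{|P_+^{k-1}f|^2}\right)d\bar\xi\right].$$ For $k=0$ (the holomorphic solutions, or equivalently the antiholomorphic ones) the second terms in the parentheses do not appear, so that $dX=-i\left[\partial\mathcal{P}_0\,d\xi+\bar\partial\mathcal{P}_0\,d\bar\xi\right]$ and $X$ is proportional to the projector $\mathcal{P}_0$. However, for $k\ne0$ (i.e. for the mixed solutions) the integral $X$ of the Weierstrass representation cannot be proportional to $\mathcal{P}_k$.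
   Context: $\partial=\partial/\partial\xi$ and $\bar\partial=\partial/\partial\bar\xi$ are the Wirtinger derivatives; $\dagger$ is Hermitian conjugation and $|v|^2=v^\dagger\cdot v$. The operator $P_+$ acts on $\mathbb{C}^N$-valued functions by $P_+g=\partial g-g\,\frac{g^\dagger\partial g}{g^\dagger g}$, with $P_+^0=\mathrm{id}$ and $P_+^k$ its $k$-fold application. Each $P_+^kf$ represents a harmonic map $S^2\to\mathbb{C}P^{N-1}$, i.e. $\partial[\bar\partial\mathcal{P}_k,\mathcal{P}_k]+\bar\partial[\partial\mathcal{P}_k,\mathcal{P}_k]=0$, so that the 1-form $dX$ is closed; $X$ denotes its integral. The source describes the solutions $P_+^kf$ with $k\neq 0$, obtained from the nonconstant holomorphic $f$ by applying $P_+$ successively, as the mixed solutions. The action of the model is $\frac14\int(D_\mu z)^\dagger(D_\mu z)\,d\xi d\bar\xi$ (summed over $\mu=1,2$), where $\xi=\xi^1+i\xi^2$, $z=f(f^\dagger\cdot f)^{-1/2}$ and $D_\mu z=\partial_{\xi^\mu}z-(z^\dagger\cdot\partial_{\xi^\mu}z)z$.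
   Formalization: For k≠0, non-proportionality is claimed only where P_k is not antiholomorphic (it fails e.g. for N=2, f=(1,ξ), k=1, where X=iP_1+const); for antiholomorphic projectors the formula reads dX=+i[∂P dξ+∂̄P dξ̄] rather than −i. *)

theory Defs
  imports "HOL-Complex_Analysis.Complex_Analysis"
begin

definition dir_deriv :: "complex \<Rightarrow> (complex \<Rightarrow> 'a::real_normed_vector) \<Rightarrow> complex \<Rightarrow> 'a" where
  "dir_deriv e g \<xi> = vector_derivative (\<lambda>t::real. g (\<xi> + of_real t * e)) (at 0)"

definition wirt :: "(complex \<Rightarrow> complex) \<Rightarrow> complex \<Rightarrow> complex" where
  "wirt g \<xi> = (dir_deriv 1 g \<xi> - \<i> * dir_deriv \<i> g \<xi>) / 2"

definition wirt_bar :: "(complex \<Rightarrow> complex) \<Rightarrow> complex \<Rightarrow> complex" where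
  "wirt_bar g \<xi> = (dir_deriv 1 g \<xi> + \<i> * dir_deriv \<i> g \<xi>) / 2"

definition wirt_vec :: "(complex \<Rightarrow> complex ^ 'n) \<Rightarrow> complex \<Rightarrow> complex ^ 'n" where
  "wirt_vec g \<xi> = (\<chi> i. wirt (\<lambda>\<zeta>. g \<zeta> $ i) \<xi>)"

definition wirt_mat :: "(complex \<Rightarrow> complex ^ 'n ^ 'm) \<Rightarrow> complex \<Rightarrow> complex ^ 'n ^ 'm" where
  "wirt_mat P \<xi> = (\<chi> i j. wirt (\<lambda>\<zeta>. P \<zeta> $ i $ j) \<xi>)"

definition wirt_bar_mat :: "(complex \<Rightarrow> complex ^ 'n ^ 'm) \<Rightarrow> complex \<Rightarrow> complex ^ 'n ^ 'm" where
  "wirt_bar_mat P \<xi> = (\<chi> i j. wirt_bar (\<lambda>\<zeta>. P \<zeta> $ i $ j) \<xi>)"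

(* On matrices the library's *s is row-wise multiplication by a vector of scalars, so scalar
   multiplication by a complex number needs its own operation. *)
definition cscale :: "complex \<Rightarrow> complex ^ 'n ^ 'm \<Rightarrow> complex ^ 'n ^ 'm" where
  "cscale c A = (\<chi> i j. c * A $ i $ j)"

definition commutator :: "complex ^ 'n ^ 'n \<Rightarrow> complex ^ 'n ^ 'n \<Rightarrow> complex ^ 'n ^ 'n" where
  "commutator A B = A ** B - B ** A"

definition hdot :: "complex ^ 'n \<Rightarrow> complex ^ 'n \<Rightarrow> complex" where
  "hdot u v = (\<Sum>i\<in>UNIV. cnj (u $ i) * v $ i)"

definition outer :: "complex ^ 'n \<Rightarrow> complex ^ 'm \<Rightarrow> complex ^ 'm ^ 'n" where
  "outer v w = (\<chi> i j. v $ i * cnj (w $ j))"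

definition rank_one_proj :: "complex ^ 'n \<Rightarrow> complex ^ 'n ^ 'n" where
  "rank_one_proj v = cscale (1 / hdot v v) (outer v v)"

definition P_plus :: "(complex \<Rightarrow> complex ^ 'n) \<Rightarrow> complex \<Rightarrow> complex ^ 'n" where
  "P_plus g \<xi> = wirt_vec g \<xi> - (hdot (g \<xi>) (wirt_vec g \<xi>) / hdot (g \<xi>) (g \<xi>)) *s g \<xi>"

definition V :: "(complex \<Rightarrow> complex ^ 'n) \<Rightarrow> nat \<Rightarrow> complex \<Rightarrow> complex ^ 'n" where
  "V f k = (P_plus ^^ k) f"

definition proj :: "(complex \<Rightarrow> complex ^ 'n) \<Rightarrow> nat \<Rightarrow> complex \<Rightarrow> complex ^ 'n ^ 'n" where
  "proj f k \<xi> = rank_one_proj (V f k \<xi>)"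

(* The points at which the formulas for V f 0, ..., V f k and proj f k make sense literally.
   Where some V f j vanishes, P_plus divides by zero, and V f (j + 1) has no meaning there. *)
definition regular_points :: "(complex \<Rightarrow> complex ^ 'n) \<Rightarrow> nat \<Rightarrow> complex set" where
  "regular_points f k =
     {\<xi>. (\<forall>i. (\<lambda>\<zeta>. f \<zeta> $ i) analytic_on {\<xi>}) \<and> (\<forall>j\<le>k. V f j \<xi> \<noteq> 0)}"

definition unit_field :: "(complex \<Rightarrow> complex ^ 'n) \<Rightarrow> complex \<Rightarrow> complex ^ 'n" where
  "unit_field f \<xi> = of_real (1 / sqrt (Re (hdot (f \<xi>) (f \<xi>)))) *s f \<xi>"

definition cov_deriv :: "complex \<Rightarrow> (complex \<Rightarrow> complex ^ 'n) \<Rightarrow> complex \<Rightarrow> complex ^ 'n" where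
  "cov_deriv e z \<xi> = dir_deriv e z \<xi> - hdot (z \<xi>) (dir_deriv e z \<xi>) *s z \<xi>"

(* The directions 1 and \<i> are those of the real coordinates of \<xi>. The area element is Lebesgue
   measure; another normalisation of d\<xi> d\<xi>bar changes the action by a positive factor only. *)
definition cpn_action :: "(complex \<Rightarrow> complex ^ 'n) \<Rightarrow> ennreal" where
  "cpn_action f =
     ennreal (1 / 4) * (\<integral>\<^sup>+ \<xi>. ennreal (\<Sum>e\<in>{1, \<i>}.
        Re (hdot (cov_deriv e (unit_field f) \<xi>) (cov_deriv e (unit_field f) \<xi>))) \<partial>lborel)"

(* f is a vector of homogeneous coordinates of a map into projective space. It may have poles,
   as in (1, w_1, ..., w_(N-1)) with rational w_i, and it may have common zeros: these
   isolated points are only singularities of the coordinates. The map is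
   defined on the sphere if proj f 0 extends to the point at infinity. A holomorphic map
   satisfies the field equations automatically, so they are not repeated here. *)
definition holomorphic_sphere_solution :: "(complex \<Rightarrow> complex ^ 'n) \<Rightarrow> bool" where
  "holomorphic_sphere_solution f \<longleftrightarrow>
     (\<forall>i. (\<lambda>\<xi>. f \<xi> $ i) meromorphic_on UNIV) \<and>
     cpn_action f < \<infinity> \<and>
     (\<exists>L. (proj f 0 \<longlongrightarrow> L) (inf at_infinity (principal (regular_points f 0))))"

(* Constancy refers to the map into projective space: (\<xi>, \<xi>) is a constant solution. *)
definition nonconstant_solution :: "(complex \<Rightarrow> complex ^ 'n) \<Rightarrow> bool" where
  "nonconstant_solution f \<longleftrightarrow> \<not> proj f 0 constant_on regular_points f 0"

definition antiholomorphic_proj ::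
    "(complex \<Rightarrow> complex ^ 'n ^ 'n) \<Rightarrow> complex set \<Rightarrow> bool" where
  "antiholomorphic_proj Q U \<longleftrightarrow>
     (\<exists>g. (\<forall>i. (\<lambda>\<xi>. cnj (g \<xi> $ i)) holomorphic_on U) \<and>
          (\<forall>\<xi>\<in>U. g \<xi> \<noteq> 0 \<and> Q \<xi> = rank_one_proj (g \<xi>)))"

(* The matrix-valued 1-form A d\<xi> + B d\<xi>bar at a point, evaluated on the tangent vector h. *)
definition one_form :: "complex ^ 'n ^ 'n \<Rightarrow> complex ^ 'n ^ 'n \<Rightarrow> complex \<Rightarrow> complex ^ 'n ^ 'n" where
  "one_form A B h = cscale h A + cscale (cnj h) B"

definition dX :: "(complex \<Rightarrow> complex ^ 'n ^ 'n) \<Rightarrow> complex \<Rightarrow> complex \<Rightarrow> complex ^ 'n ^ 'n" where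
  "dX Q \<xi> = one_form (cscale \<i> (- commutator (wirt_mat Q \<xi>) (Q \<xi>)))
                     (cscale \<i> (commutator (wirt_bar_mat Q \<xi>) (Q \<xi>)))"

definition weierstrass_integral ::
    "(complex \<Rightarrow> complex ^ 'n ^ 'n) \<Rightarrow> (complex \<Rightarrow> complex ^ 'n ^ 'n) \<Rightarrow> complex set \<Rightarrow> bool" where
  "weierstrass_integral X Q U \<longleftrightarrow> (\<forall>\<xi>\<in>U. (X has_derivative dX Q \<xi>) (at \<xi>))"

(* The integral X is only determined up to an additive constant matrix, hence C. *)
definition proportional_with ::
    "complex \<Rightarrow> (complex \<Rightarrow> complex ^ 'n ^ 'n) \<Rightarrow> (complex \<Rightarrow> complex ^ 'n ^ 'n) \<Rightarrow> complex set \<Rightarrow> bool" where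
  "proportional_with c X Q U \<longleftrightarrow> (\<exists>C. \<forall>\<xi>\<in>U. X \<xi> = cscale c (Q \<xi>) + C)"

end

theory Submission
  imports Defs
begin

text \<open>Where they are nonzero, the vectors \<open>V\<^sub>k\<close> are the Gram-Schmidt orthogonalisation of
  \<open>f, f', f'', \<dots>\<close>. Hence they are pairwise orthogonal, and differentiating the orthogonality
  relations gives \<open>\<partial>V\<^sub>k \<equiv> V\<^sub>k\<^sub>+\<^sub>1\<close> modulo \<open>V\<^sub>k\<close> and
  \<open>\<partial>\<^sup>- V\<^sub>k = - (|V\<^sub>k|\<^sup>2 / |V\<^sub>k\<^sub>-\<^sub>1|\<^sup>2) V\<^sub>k\<^sub>-\<^sub>1\<close>, where \<open>\<partial>\<^sup>-\<close> is
  the derivative with respect to the conjugate variable. With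
  \<open>R\<^sub>k = V\<^sub>k\<^sub>+\<^sub>1 \<otimes> V\<^sub>k\<^sup>\<dagger> / |V\<^sub>k|\<^sup>2\<close> this says \<open>\<partial>P\<^sub>k = R\<^sub>k - R\<^sub>k\<^sub>-\<^sub>1\<close> and
  \<open>[\<partial>P\<^sub>k, P\<^sub>k] = R\<^sub>k + R\<^sub>k\<^sub>-\<^sub>1\<close>, so by telescoping
  \<open>X = -i (P\<^sub>k + 2 (P\<^sub>0 + \<dots> + P\<^sub>k\<^sub>-\<^sub>1))\<close> is a Weierstrass integral.
  If \<open>X = c P\<^sub>k + C\<close>, then \<open>-i (R\<^sub>k + R\<^sub>k\<^sub>-\<^sub>1) = c (R\<^sub>k - R\<^sub>k\<^sub>-\<^sub>1)\<close>; evaluating at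
  \<open>V\<^sub>k\<^sub>-\<^sub>1\<close> gives \<open>c = i\<close>, and then evaluating at \<open>V\<^sub>k\<close> gives \<open>V\<^sub>k\<^sub>+\<^sub>1 = 0\<close>, which makes
  \<open>V\<^sub>k / |V\<^sub>k|\<^sup>2\<close> antiholomorphic.\<close>

(* The imported theories leave this notation active, which makes every vector component ambiguous. *)
no_notation fps_nth (infixl "$" 75)

subsection \<open>Wirtinger derivatives\<close>

text \<open>Every real-linear map on the complex numbers has the form
  \<open>a * h + b * cnj h\<close> with unique \<open>a\<close> and \<open>b\<close>, so this
  packages real differentiability with both Wirtinger derivatives. The bare equation
  \<open>wirt g \<xi> = a\<close> says nothing about differentiability and would support neither
  product nor quotient rule.\<close>

definition has_wirt :: "(complex \<Rightarrow> complex) \<Rightarrow> complex \<Rightarrow> complex \<Rightarrow> complex \<Rightarrow> bool" where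
  "has_wirt g a b \<xi> \<longleftrightarrow> (g has_derivative (\<lambda>h. a * h + b * cnj h)) (at \<xi>)"

definition has_wirt_vec ::
    "(complex \<Rightarrow> complex ^ 'n) \<Rightarrow> complex ^ 'n \<Rightarrow> complex ^ 'n \<Rightarrow> complex \<Rightarrow> bool" where
  "has_wirt_vec g A B \<xi> \<longleftrightarrow> (\<forall>i. has_wirt (\<lambda>\<zeta>. g \<zeta> $ i) (A $ i) (B $ i) \<xi>)"

definition has_wirt_mat ::
    "(complex \<Rightarrow> complex ^ 'n ^ 'm) \<Rightarrow> complex ^ 'n ^ 'm \<Rightarrow> complex ^ 'n ^ 'm \<Rightarrow> complex \<Rightarrow> bool" where
  "has_wirt_mat P A B \<xi> \<longleftrightarrow> (\<forall>i j. has_wirt (\<lambda>\<zeta>. P \<zeta> $ i $ j) (A $ i $ j) (B $ i $ j) \<xi>)"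

lemma has_wirt_const: "has_wirt (\<lambda>_. c) 0 0 \<xi>"
  unfolding has_wirt_def by simp

lemma has_wirt_add:
  assumes "has_wirt g a b \<xi>" and "has_wirt h c d \<xi>"
  shows "has_wirt (\<lambda>\<zeta>. g \<zeta> + h \<zeta>) (a + c) (b + d) \<xi>"
  using has_derivative_add[OF assms[unfolded has_wirt_def]]
  unfolding has_wirt_def by (simp add: algebra_simps)

lemma has_wirt_diff:
  assumes "has_wirt g a b \<xi>" and "has_wirt h c d \<xi>"
  shows "has_wirt (\<lambda>\<zeta>. g \<zeta> - h \<zeta>) (a - c) (b - d) \<xi>"
  using has_derivative_diff[OF assms[unfolded has_wirt_def]]
  unfolding has_wirt_def by (simp add: algebra_simps)

lemma has_wirt_mult:
  assumes "has_wirt g a b \<xi>" and "has_wirt h c d \<xi>"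
  shows "has_wirt (\<lambda>\<zeta>. g \<zeta> * h \<zeta>) (g \<xi> * c + a * h \<xi>) (g \<xi> * d + b * h \<xi>) \<xi>"
  using has_derivative_mult[OF assms[unfolded has_wirt_def]]
  unfolding has_wirt_def by (simp add: algebra_simps)

lemma has_wirt_inverse:
  assumes "has_wirt g a b \<xi>" and "g \<xi> \<noteq> 0"
  shows "has_wirt (\<lambda>\<zeta>. inverse (g \<zeta>)) (- a / (g \<xi>)\<^sup>2) (- b / (g \<xi>)\<^sup>2) \<xi>"
proof -
  have "(\<lambda>h. - (inverse (g \<xi>) * (a * h + b * cnj h) * inverse (g \<xi>))) =
        (\<lambda>h. - a / (g \<xi>)\<^sup>2 * h + - b / (g \<xi>)\<^sup>2 * cnj h)"
    using assms(2) by (auto simp: field_simps power2_eq_square)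
  with Deriv.has_derivative_inverse[OF assms(2) assms(1)[unfolded has_wirt_def]]
  show ?thesis unfolding has_wirt_def by simp
qed

lemma has_wirt_divide:
  assumes "has_wirt g a b \<xi>" and "has_wirt h c d \<xi>" and "h \<xi> \<noteq> 0"
  shows "has_wirt (\<lambda>\<zeta>. g \<zeta> / h \<zeta>) (a / h \<xi> - g \<xi> * c / (h \<xi>)\<^sup>2) (b / h \<xi> - g \<xi> * d / (h \<xi>)\<^sup>2) \<xi>"
  using has_wirt_mult[OF assms(1) has_wirt_inverse[OF assms(2,3)]]
  by (simp add: divide_inverse algebra_simps)

lemma has_wirt_cnj:
  assumes "has_wirt g a b \<xi>"
  shows "has_wirt (\<lambda>\<zeta>. cnj (g \<zeta>)) (cnj b) (cnj a) \<xi>"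
  using has_derivative_cnj[OF assms[unfolded has_wirt_def]]
  unfolding has_wirt_def by (simp add: algebra_simps)

lemma has_wirt_sum:
  assumes "\<And>i. i \<in> I \<Longrightarrow> has_wirt (g i) (a i) (b i) \<xi>"
  shows "has_wirt (\<lambda>\<zeta>. \<Sum>i\<in>I. g i \<zeta>) (\<Sum>i\<in>I. a i) (\<Sum>i\<in>I. b i) \<xi>"
proof -
  have "(\<lambda>h. \<Sum>i\<in>I. a i * h + b i * cnj h) = (\<lambda>h. (\<Sum>i\<in>I. a i) * h + (\<Sum>i\<in>I. b i) * cnj h)"
    by (simp add: sum.distrib sum_distrib_right)
  with has_derivative_sum[of I g "\<lambda>i h. a i * h + b i * cnj h" "at \<xi>"] assms
  show ?thesis unfolding has_wirt_def by simp
qed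

lemma has_wirt_DERIV:
  assumes "(g has_field_derivative a) (at \<xi>)"
  shows "has_wirt g a 0 \<xi>"
  using assms unfolding has_wirt_def has_field_derivative_def by simp

text \<open>Locality of the derivative. The fields \<open>V f k\<close> and the projectors agree
  with their differentiable models only on open sets.\<close>

lemma has_wirt_cong_open:
  assumes "has_wirt g a b \<xi>" and "open S" and "\<xi> \<in> S" and "\<And>\<zeta>. \<zeta> \<in> S \<Longrightarrow> g \<zeta> = h \<zeta>"
  shows "has_wirt h a b \<xi>"
  using assms has_derivative_transform_within_open unfolding has_wirt_def by blast

text \<open>Chain rule along the real line through \<xi> in direction \<open>e\<close>. The
  directions 1 and \<open>\<i>\<close> yield \<open>a + b\<close> and \<open>\<i> * (a - b)\<close>,
  from which \<open>wirt\<close> and \<open>wirt_bar\<close> recover \<open>a\<close> and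
  \<open>b\<close>.\<close>

lemma has_wirt_dir_deriv:
  assumes "has_wirt g a b \<xi>"
  shows "dir_deriv e g \<xi> = a * e + b * cnj e"
proof -
  have "((\<lambda>t::real. \<xi> + of_real t * e) has_derivative (\<lambda>t. of_real t * e)) (at 0)"
    by (auto intro!: derivative_eq_intros)
  moreover have "(g has_derivative (\<lambda>h. a * h + b * cnj h)) (at (\<xi> + of_real 0 * e))"
    using assms by (simp add: has_wirt_def)
  ultimately have "((\<lambda>t::real. g (\<xi> + of_real t * e)) has_derivative
      (\<lambda>t. a * (of_real t * e) + b * cnj (of_real t * e))) (at 0)"
    by (rule has_derivative_compose)
  hence "((\<lambda>t::real. g (\<xi> + of_real t * e)) has_vector_derivative (a * e + b * cnj e)) (at 0)"
    unfolding has_vector_derivative_def by (simp add: scaleR_conv_of_real algebra_simps)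
  thus ?thesis unfolding dir_deriv_def by (rule vector_derivative_at)
qed

lemma has_wirt_imp_wirt:
  assumes "has_wirt g a b \<xi>"
  shows "wirt g \<xi> = a" and "wirt_bar g \<xi> = b"
  unfolding wirt_def wirt_bar_def has_wirt_dir_deriv[OF assms]
  by (simp_all add: algebra_simps flip: mult.assoc)

text \<open>This is what allows an identity to be differentiated: two computations of the derivative
  of one function may be compared coefficient by coefficient.\<close>

lemma has_wirt_unique:
  assumes "has_wirt g a b \<xi>" and "has_wirt g a' b' \<xi>"
  shows "a = a'" and "b = b'"
  using assms has_wirt_imp_wirt by metis+

lemma has_wirt_vec_imp_wirt_vec:
  assumes "has_wirt_vec g A B \<xi>"
  shows "wirt_vec g \<xi> = A"
  using assms unfolding has_wirt_vec_def wirt_vec_def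
  by (auto simp: vec_eq_iff intro: has_wirt_imp_wirt)

lemma has_wirt_mat_imp_wirt_mat:
  assumes "has_wirt_mat P A B \<xi>"
  shows "wirt_mat P \<xi> = A" and "wirt_bar_mat P \<xi> = B"
  using assms unfolding has_wirt_mat_def wirt_mat_def wirt_bar_mat_def
  by (auto simp: vec_eq_iff intro: has_wirt_imp_wirt)

lemma has_wirt_vec_diff:
  assumes "has_wirt_vec g A B \<xi>" and "has_wirt_vec h C D \<xi>"
  shows "has_wirt_vec (\<lambda>\<zeta>. g \<zeta> - h \<zeta>) (A - C) (B - D) \<xi>"
  using assms unfolding has_wirt_vec_def by (simp add: has_wirt_diff)

lemma has_wirt_vec_scale:
  assumes "has_wirt c a b \<xi>" and "has_wirt_vec g A B \<xi>"
  shows "has_wirt_vec (\<lambda>\<zeta>. c \<zeta> *s g \<zeta>) (c \<xi> *s A + a *s g \<xi>) (c \<xi> *s B + b *s g \<xi>) \<xi>"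
  using assms unfolding has_wirt_vec_def by (auto intro: has_wirt_mult)

lemma has_wirt_vec_sum:
  assumes "\<And>i. i \<in> I \<Longrightarrow> has_wirt_vec (g i) (A i) (B i) \<xi>"
  shows "has_wirt_vec (\<lambda>\<zeta>. \<Sum>i\<in>I. g i \<zeta>) (\<Sum>i\<in>I. A i) (\<Sum>i\<in>I. B i) \<xi>"
  using assms unfolding has_wirt_vec_def by (simp add: has_wirt_sum)

lemma has_wirt_vec_cong_open:
  assumes "has_wirt_vec g A B \<xi>" and "open S" and "\<xi> \<in> S" and "\<And>\<zeta>. \<zeta> \<in> S \<Longrightarrow> g \<zeta> = h \<zeta>"
  shows "has_wirt_vec h A B \<xi>"
  unfolding has_wirt_vec_def
proof
  fix i
  show "has_wirt (\<lambda>\<zeta>. h \<zeta> $ i) (A $ i) (B $ i) \<xi>"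
    by (rule has_wirt_cong_open[of "\<lambda>\<zeta>. g \<zeta> $ i" _ _ _ S])
       (use assms in \<open>auto simp: has_wirt_vec_def\<close>)
qed

lemma has_wirt_vec_isCont:
  assumes "has_wirt_vec g A B \<xi>"
  shows "isCont g \<xi>"
proof -
  have "isCont (\<lambda>\<zeta>. g \<zeta> $ i) \<xi>" for i
    using assms has_derivative_continuous unfolding has_wirt_vec_def has_wirt_def by blast
  hence "isCont (\<lambda>\<zeta>. \<chi> i. g \<zeta> $ i) \<xi>"
    unfolding isCont_def by (intro vec_tendstoI) simp
  thus ?thesis by simp
qed

lemma has_wirt_mat_add:
  assumes "has_wirt_mat P A B \<xi>" and "has_wirt_mat Q C D \<xi>"
  shows "has_wirt_mat (\<lambda>\<zeta>. P \<zeta> + Q \<zeta>) (A + C) (B + D) \<xi>"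
  using assms unfolding has_wirt_mat_def by (simp add: has_wirt_add)

lemma has_wirt_mat_cscale:
  assumes "has_wirt_mat P A B \<xi>"
  shows "has_wirt_mat (\<lambda>\<zeta>. cscale c (P \<zeta>)) (cscale c A) (cscale c B) \<xi>"
  unfolding has_wirt_mat_def
proof (intro allI)
  fix i j
  show "has_wirt (\<lambda>\<zeta>. cscale c (P \<zeta>) $ i $ j) (cscale c A $ i $ j) (cscale c B $ i $ j) \<xi>"
    using has_wirt_mult[OF has_wirt_const[of c] assms[unfolded has_wirt_mat_def, rule_format, of i j]]
    by (simp add: cscale_def)
qed

lemma has_wirt_mat_const: "has_wirt_mat (\<lambda>_. C) 0 0 \<xi>"
  unfolding has_wirt_mat_def by (simp add: has_wirt_const)

lemma has_wirt_mat_cong_open: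
  assumes "has_wirt_mat P A B \<xi>" and "open S" and "\<xi> \<in> S" and "\<And>\<zeta>. \<zeta> \<in> S \<Longrightarrow> P \<zeta> = Q \<zeta>"
  shows "has_wirt_mat Q A B \<xi>"
  unfolding has_wirt_mat_def
proof (intro allI)
  fix i j
  show "has_wirt (\<lambda>\<zeta>. Q \<zeta> $ i $ j) (A $ i $ j) (B $ i $ j) \<xi>"
    by (rule has_wirt_cong_open[of "\<lambda>\<zeta>. P \<zeta> $ i $ j" _ _ _ S])
       (use assms in \<open>auto simp: has_wirt_mat_def\<close>)
qed

text \<open>The basis consists of basis vectors of the component space placed on single axes, so
  componentwise differentiability can be regrouped by axis. Applied twice to a matrix, this reaches
  the entries.\<close>

lemma has_derivative_vec_iff:
  fixes F :: "'a::real_normed_vector \<Rightarrow> 'b::euclidean_space ^ 'n"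
  shows "(F has_derivative F') (at x) \<longleftrightarrow>
    (\<forall>i. ((\<lambda>y. F y $ i) has_derivative (\<lambda>h. F' h $ i)) (at x))"
proof -
  have "(F has_derivative F') (at x) \<longleftrightarrow>
      (\<forall>i. \<forall>b\<in>Basis. ((\<lambda>y. F y $ i \<bullet> b) has_derivative (\<lambda>h. F' h $ i \<bullet> b)) (at x))"
    unfolding has_derivative_componentwise_within[of F] by (auto simp: Basis_vec_def inner_axis)
  also have "\<dots> \<longleftrightarrow> (\<forall>i. ((\<lambda>y. F y $ i) has_derivative (\<lambda>h. F' h $ i)) (at x))"
    by (subst has_derivative_componentwise_within) simp
  finally show ?thesis .
qed

text \<open>Link between the entrywise Wirtinger calculus and \<open>weierstrass_integral\<close>,
  which speaks of Frechet derivatives.\<close>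

lemma has_wirt_mat_iff_has_derivative:
  fixes P :: "complex \<Rightarrow> complex ^ 'n ^ 'n"
  shows "has_wirt_mat P A B \<xi> \<longleftrightarrow> (P has_derivative one_form A B) (at \<xi>)"
  unfolding has_wirt_mat_def has_wirt_def has_derivative_vec_iff one_form_def
  by (simp add: cscale_def mult.commute)

subsection \<open>Hermitian algebra\<close>

lemma hdot_simps:
  "hdot u (v + w) = hdot u v + hdot u w" "hdot u (v - w) = hdot u v - hdot u w"
  "hdot (u + v) w = hdot u w + hdot v w" "hdot (u - v) w = hdot u w - hdot v w"
  "hdot u (c *s v) = c * hdot u v" "hdot (c *s u) v = cnj c * hdot u v"
  "hdot u 0 = 0" "hdot 0 u = 0"
  "hdot (- u) v = - hdot u v" "hdot u (- v) = - hdot u v"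
  unfolding hdot_def
  by (simp_all add: algebra_simps sum.distrib sum_subtractf sum_distrib_left sum_negf)

lemma hdot_sum_right: "hdot u (\<Sum>i\<in>I. g i) = (\<Sum>i\<in>I. hdot u (g i))"
  unfolding hdot_def by (simp add: sum_distrib_left) (rule sum.swap)

lemma cnj_hdot: "cnj (hdot u v) = hdot v u"
  unfolding hdot_def by (simp add: mult.commute)

lemma hdot_commute_0: "hdot u v = 0 \<longleftrightarrow> hdot v u = 0"
  by (metis cnj_hdot complex_cnj_zero)

lemma hdot_self_eq_0_iff [simp]: "hdot v v = 0 \<longleftrightarrow> v = 0"
proof -
  have "hdot v v = of_real (\<Sum>i\<in>UNIV. (cmod (v $ i))\<^sup>2)"
    unfolding hdot_def by (simp add: complex_norm_square mult.commute del: of_real_power)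
  moreover have "(\<Sum>i\<in>UNIV. (cmod (v $ i))\<^sup>2) = 0 \<longleftrightarrow> v = 0"
    by (subst sum_nonneg_eq_0_iff) (auto simp: vec_eq_iff)
  ultimately show ?thesis by (simp only: of_real_eq_0_iff)
qed

lemma has_wirt_hdot:
  assumes "has_wirt_vec g A B \<xi>" and "has_wirt_vec h C D \<xi>"
  shows "has_wirt (\<lambda>\<zeta>. hdot (g \<zeta>) (h \<zeta>))
    (hdot (g \<xi>) C + hdot B (h \<xi>)) (hdot (g \<xi>) D + hdot A (h \<xi>)) \<xi>"
proof -
  have "has_wirt (\<lambda>\<zeta>. \<Sum>i\<in>UNIV. cnj (g \<zeta> $ i) * h \<zeta> $ i)
     (\<Sum>i\<in>UNIV. cnj (g \<xi> $ i) * C $ i + cnj (B $ i) * h \<xi> $ i)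
     (\<Sum>i\<in>UNIV. cnj (g \<xi> $ i) * D $ i + cnj (A $ i) * h \<xi> $ i) \<xi>"
    using assms unfolding has_wirt_vec_def
    by (intro has_wirt_sum has_wirt_mult has_wirt_cnj) auto
  thus ?thesis unfolding hdot_def by (simp add: sum.distrib)
qed

lemma outer_mult_outer: "outer u v ** outer w x = cscale (hdot v w) (outer u x)"
  unfolding outer_def matrix_matrix_mult_def cscale_def hdot_def
  by (simp add: vec_eq_iff sum_distrib_right sum_distrib_left mult_ac)

lemma matrix_add_rdistrib: "(A + B) ** C = A ** C + B ** (C :: 'a::semiring_1 ^ 'n ^ 'm)"
  by (simp add: matrix_matrix_mult_def vec_eq_iff sum.distrib algebra_simps)

lemma cscale_mult: "cscale c A ** B = cscale c (A ** B)" "A ** cscale c B = cscale c (A ** B)"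
  unfolding matrix_matrix_mult_def cscale_def
  by (simp_all add: vec_eq_iff sum_distrib_left mult_ac)

lemma cscale_simps:
  "cscale c (A + B) = cscale c A + cscale c B" "cscale c (A - B) = cscale c A - cscale c B"
  "cscale c (- A) = - cscale c A" "cscale c 0 = 0" "cscale 0 A = 0" "cscale 1 A = A"
  "cscale c (cscale d A) = cscale (c * d) A"
  unfolding cscale_def by (simp_all add: vec_eq_iff algebra_simps)

lemma outer_simps: "outer 0 v = 0" "outer v 0 = 0"
    "outer u (c *s v) = cscale (cnj c) (outer u v)" "outer (c *s u) v = cscale c (outer u v)"
    "outer u (v + w) = outer u v + outer u w" "outer (u + v) w = outer u w + outer v w"
  unfolding outer_def cscale_def by (simp_all add: vec_eq_iff algebra_simps)

lemma outer_mult_vec: "outer u v *v w = hdot v w *s u"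
  unfolding outer_def matrix_vector_mult_def hdot_def
  by (simp add: vec_eq_iff sum_distrib_left mult_ac)

text \<open>Numerator and denominator both acquire the factor \<open>c * cnj c\<close>. This permits
  replacing \<open>V f k\<close> by a rescaled antiholomorphic representative of the same
  projector.\<close>

lemma rank_one_proj_scale:
  assumes "c \<noteq> 0" shows "rank_one_proj (c *s v) = rank_one_proj v"
  using assms unfolding rank_one_proj_def
  by (simp add: hdot_simps outer_simps cscale_simps divide_simps)

section \<open>Rank-one projectors: derivatives and commutators\<close>

definition orth_part :: "complex ^ 'n \<Rightarrow> complex ^ 'n \<Rightarrow> complex ^ 'n" where
  "orth_part g x = x - (hdot g x / hdot g g) *s g"

lemma hdot_orth_part: "hdot g (orth_part g x) = 0"
  by (cases "g = 0") (simp_all add: orth_part_def hdot_simps)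

lemma P_plus_eq_orth_part: "P_plus g \<xi> = orth_part (g \<xi>) (wirt_vec g \<xi>)"
  by (simp add: P_plus_def orth_part_def)

text \<open>Quotient rule. The derivative of the norm square in the denominator removes exactly the
  components of \<open>A\<close> and \<open>B\<close> along \<open>g \<xi>\<close>, in accordance
  with the invariance of the projector under rescaling.\<close>

lemma has_wirt_mat_rank_one_proj:
  assumes g: "has_wirt_vec g A B \<xi>" and nz: "g \<xi> \<noteq> 0"
  defines "n \<equiv> 1 / hdot (g \<xi>) (g \<xi>)"
  shows "has_wirt_mat (\<lambda>\<zeta>. rank_one_proj (g \<zeta>))
    (cscale n (outer (orth_part (g \<xi>) A) (g \<xi>) + outer (g \<xi>) (orth_part (g \<xi>) B)))
    (cscale n (outer (orth_part (g \<xi>) B) (g \<xi>) + outer (g \<xi>) (orth_part (g \<xi>) A))) \<xi>"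
  unfolding has_wirt_mat_def
proof (intro allI)
  fix i j
  let ?N = "hdot (g \<xi>) (g \<xi>)"
  have N: "?N \<noteq> 0" using nz by simp
  have gi: "has_wirt (\<lambda>\<zeta>. g \<zeta> $ i) (A $ i) (B $ i) \<xi>" for i
    using g by (simp add: has_wirt_vec_def)
  \<comment> \<open>Here \<open>a\<close>, \<open>b\<close>, \<open>u\<close>, \<open>v\<close>
    stand for the entries of \<open>A\<close>, \<open>cnj B\<close>, \<open>g\<close>,
    \<open>cnj g\<close>, and \<open>m\<close> for the norm square. Its derivative
    \<open>r + s\<close> is split so that \<open>r\<close> completes \<open>a\<close>, and
    \<open>s\<close> completes \<open>b\<close>, to an entry of an orthogonal part.\<close>
  have projector_entry: "(u * b + a * v) / m - u * v * (r + s) / m\<^sup>2 =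
      ((a - r * u / m) * v + u * (b - s * v / m)) / m" for a b u v r s m :: complex
    unfolding divide_inverse power2_eq_square by (simp add: algebra_simps)
  have "has_wirt (\<lambda>\<zeta>. (g \<zeta> $ i * cnj (g \<zeta> $ j)) / hdot (g \<zeta>) (g \<zeta>))
     ((g \<xi> $ i * cnj (B $ j) + A $ i * cnj (g \<xi> $ j)) / ?N -
        (g \<xi> $ i * cnj (g \<xi> $ j)) * (hdot (g \<xi>) A + hdot B (g \<xi>)) / ?N\<^sup>2)
     ((g \<xi> $ i * cnj (A $ j) + B $ i * cnj (g \<xi> $ j)) / ?N -
        (g \<xi> $ i * cnj (g \<xi> $ j)) * (hdot (g \<xi>) B + hdot A (g \<xi>)) / ?N\<^sup>2) \<xi>"
    by (rule has_wirt_divide[OF has_wirt_mult[OF gi[of i] has_wirt_cnj[OF gi[of j]]]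
          has_wirt_hdot[OF g g] N])
  also have "(\<lambda>\<zeta>. (g \<zeta> $ i * cnj (g \<zeta> $ j)) / hdot (g \<zeta>) (g \<zeta>)) =
      (\<lambda>\<zeta>. rank_one_proj (g \<zeta>) $ i $ j)"
    by (simp add: rank_one_proj_def cscale_def outer_def)
  also have "(g \<xi> $ i * cnj (B $ j) + A $ i * cnj (g \<xi> $ j)) / ?N -
        (g \<xi> $ i * cnj (g \<xi> $ j)) * (hdot (g \<xi>) A + hdot B (g \<xi>)) / ?N\<^sup>2 =
      cscale n (outer (orth_part (g \<xi>) A) (g \<xi>) + outer (g \<xi>) (orth_part (g \<xi>) B)) $ i $ j"
    by (simp add: n_def cscale_def outer_def orth_part_def cnj_hdot projector_entry)
  also have "(g \<xi> $ i * cnj (A $ j) + B $ i * cnj (g \<xi> $ j)) / ?N -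
        (g \<xi> $ i * cnj (g \<xi> $ j)) * (hdot (g \<xi>) B + hdot A (g \<xi>)) / ?N\<^sup>2 =
      cscale n (outer (orth_part (g \<xi>) B) (g \<xi>) + outer (g \<xi>) (orth_part (g \<xi>) A)) $ i $ j"
    by (simp add: n_def cscale_def outer_def orth_part_def cnj_hdot projector_entry)
  finally show "has_wirt (\<lambda>\<zeta>. rank_one_proj (g \<zeta>) $ i $ j)
     (cscale n (outer (orth_part (g \<xi>) A) (g \<xi>) + outer (g \<xi>) (orth_part (g \<xi>) B)) $ i $ j)
     (cscale n (outer (orth_part (g \<xi>) B) (g \<xi>) + outer (g \<xi>) (orth_part (g \<xi>) A)) $ i $ j) \<xi>" .
qed

text \<open>The projector fixes \<open>outer x g\<close> when multiplied from the right and
  annihilates it from the left, since \<open>x\<close> is orthogonal to \<open>g\<close>; for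
  \<open>outer g y\<close> it is the other way round. So the commutator only flips the sign of the
  second term.\<close>

lemma commutator_rank_one_proj:
  fixes g x y :: "complex ^ 'n"
  assumes x: "hdot g x = 0" and y: "hdot g y = 0"
  shows "commutator (cscale n (outer x g + outer g y)) (rank_one_proj g) =
    cscale n (outer x g - outer g y)"
proof (cases "g = 0")
  case False
  have "hdot y g = 0" using y hdot_commute_0 by blast
  with False x show ?thesis
    by (simp add: commutator_def rank_one_proj_def matrix_add_ldistrib matrix_add_rdistrib
        cscale_mult outer_mult_outer cscale_simps)
qed (simp add: outer_simps commutator_def rank_one_proj_def cscale_simps)

text \<open>Only the parts of the two derivatives orthogonal to \<open>g \<xi>\<close> enter. The
  opposite signs in front of the two commutators of \<open>dX\<close> are absorbed by exchanging the
  terms of the second, so both coefficients carry \<open>- \<i>\<close>. The lemma serves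
  \<open>V f k\<close> and antiholomorphic representatives alike.\<close>

lemma dX_rank_one_proj:
  fixes g :: "complex \<Rightarrow> complex ^ 'n"
  assumes g: "has_wirt_vec g A B \<xi>" and nz: "g \<xi> \<noteq> 0"
    and Q: "open S" "\<xi> \<in> S" "\<And>\<zeta>. \<zeta> \<in> S \<Longrightarrow> Q \<zeta> = rank_one_proj (g \<zeta>)"
  defines "n \<equiv> 1 / hdot (g \<xi>) (g \<xi>)"
  defines "x \<equiv> orth_part (g \<xi>) A" and "y \<equiv> orth_part (g \<xi>) B"
  shows "has_wirt_mat Q (cscale n (outer x (g \<xi>) + outer (g \<xi>) y))
      (cscale n (outer y (g \<xi>) + outer (g \<xi>) x)) \<xi>"
    and "dX Q \<xi> = one_form (cscale (- \<i>) (cscale n (outer x (g \<xi>) - outer (g \<xi>) y)))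
      (cscale (- \<i>) (cscale n (outer (g \<xi>) x - outer y (g \<xi>))))"
proof -
  show *: "has_wirt_mat Q (cscale n (outer x (g \<xi>) + outer (g \<xi>) y))
      (cscale n (outer y (g \<xi>) + outer (g \<xi>) x)) \<xi>"
    unfolding n_def x_def y_def
    by (rule has_wirt_mat_cong_open[OF has_wirt_mat_rank_one_proj[OF g nz] Q(1,2)]) (simp add: Q(3))
  have comm: "commutator (wirt_mat Q \<xi>) (Q \<xi>) = cscale n (outer x (g \<xi>) - outer (g \<xi>) y)"
    "commutator (wirt_bar_mat Q \<xi>) (Q \<xi>) = cscale n (outer y (g \<xi>) - outer (g \<xi>) x)"
    unfolding has_wirt_mat_imp_wirt_mat[OF *] Q(3)[OF Q(2)]
    by (simp_all add: commutator_rank_one_proj x_def y_def hdot_orth_part)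
  show "dX Q \<xi> = one_form (cscale (- \<i>) (cscale n (outer x (g \<xi>) - outer (g \<xi>) y)))
      (cscale (- \<i>) (cscale n (outer (g \<xi>) x - outer y (g \<xi>))))"
    unfolding dX_def comm
    by (auto simp: cscale_def vec_eq_iff algebra_simps intro!: arg_cong2[where f = one_form])
qed

subsection \<open>Gram-Schmidt orthogonalisation of the jets of a holomorphic curve\<close>

text \<open>Unnormalised, so that no square roots have to be differentiated. A vanishing earlier
  vector contributes 0, hence linearly dependent families are allowed.\<close>

fun gram_schmidt :: "(nat \<Rightarrow> complex ^ 'n) \<Rightarrow> nat \<Rightarrow> complex ^ 'n" where
  "gram_schmidt u n = u n - (\<Sum>j<n. (hdot (gram_schmidt u j) (u n) /
     hdot (gram_schmidt u j) (gram_schmidt u j)) *s gram_schmidt u j)"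

declare gram_schmidt.simps [simp del]

text \<open>By induction, pairing the subtracted sum with vector \<open>i\<close> leaves only the
  term \<open>l = i\<close>, which reproduces \<open>hdot (gram_schmidt u i) (u j)\<close> and
  cancels it. If vector \<open>i\<close> is zero, both quantities are 0.\<close>

lemma gram_schmidt_orthogonal_less:
  "i < j \<Longrightarrow> hdot (gram_schmidt u i) (gram_schmidt u j) = 0"
proof (induction j arbitrary: i rule: less_induct)
  case (less j)
  let ?e = "gram_schmidt u"
  have "hdot (?e i) (\<Sum>l<j. (hdot (?e l) (u j) / hdot (?e l) (?e l)) *s ?e l) =
      (\<Sum>l<j. if l = i then hdot (?e i) (u j) else 0)"
    unfolding hdot_sum_right
  proof (rule sum.cong[OF refl])
    fix l assume l: "l \<in> {..<j}"
    have "hdot (?e i) (?e l) = 0" if "l \<noteq> i"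
      using that less l by (metis hdot_commute_0 lessThan_iff nat_neq_iff)
    thus "hdot (?e i) ((hdot (?e l) (u j) / hdot (?e l) (?e l)) *s ?e l) =
        (if l = i then hdot (?e i) (u j) else 0)"
      by (auto simp: hdot_simps)
  qed
  also have "\<dots> = hdot (?e i) (u j)" using less.prems by simp
  finally show ?case by (subst gram_schmidt.simps) (simp add: hdot_simps)
qed

lemma gram_schmidt_orthogonal:
  "i \<noteq> j \<Longrightarrow> hdot (gram_schmidt u i) (gram_schmidt u j) = 0"
  by (metis gram_schmidt_orthogonal_less hdot_commute_0 nat_neq_iff)

lemma in_span_gram_schmidt: "u n \<in> vec.span (gram_schmidt u ` {..<Suc n})"
proof -
  have "u n = gram_schmidt u n + (\<Sum>j<n. (hdot (gram_schmidt u j) (u n) /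
     hdot (gram_schmidt u j) (gram_schmidt u j)) *s gram_schmidt u j)"
    by (subst (1) gram_schmidt.simps) simp
  also have "\<dots> \<in> vec.span (gram_schmidt u ` {..<Suc n})"
    by (intro vec.span_add vec.span_sum vec.span_scale vec.span_base) auto
  finally show ?thesis .
qed

lemma hdot_span_eq_0:
  assumes "x \<in> vec.span S" and "\<And>s. s \<in> S \<Longrightarrow> hdot w s = 0"
  shows "hdot w x = 0"
  using assms(1)
proof (induction rule: vec.span_induct_alt)
  case base
  show ?case by (simp add: hdot_simps)
next
  case (step c x y)
  thus ?case using assms(2) by (simp add: hdot_simps)
qed

text \<open>Such a vector is orthogonal to itself. This turns derivatives known modulo a span into
  exact formulas.\<close>

lemma eq_0_if_in_span_orthogonal:
  assumes "x \<in> vec.span S" and "\<And>s. s \<in> S \<Longrightarrow> hdot s x = 0"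
  shows "x = 0"
  using hdot_span_eq_0[OF assms(1), of x] assms(2) hdot_commute_0 by auto

section \<open>The moving frame of a holomorphic curve and its derivatives\<close>

definition jet :: "(complex \<Rightarrow> complex ^ 'n) \<Rightarrow> complex \<Rightarrow> nat \<Rightarrow> complex ^ 'n" where
  "jet f \<xi> n = (\<chi> i. (deriv ^^ n) (\<lambda>\<zeta>. f \<zeta> $ i) \<xi>)"

text \<open>The model for \<open>V f n\<close>. It is an explicit expression in the jets, so
  differentiability can be established directly, whereas the recursion for \<open>V\<close> involves
  the total function \<open>wirt_vec\<close>.\<close>

definition frame :: "(complex \<Rightarrow> complex ^ 'n) \<Rightarrow> nat \<Rightarrow> complex \<Rightarrow> complex ^ 'n" where
  "frame f n \<xi> = gram_schmidt (jet f \<xi>) n"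

text \<open>The bound is strict: the denominators in \<open>frame f k\<close> involve only indices
  below \<open>k\<close>, and \<open>frame f k\<close> itself may vanish here.\<close>

definition frame_domain :: "(complex \<Rightarrow> complex ^ 'n) \<Rightarrow> nat \<Rightarrow> complex set" where
  "frame_domain f k =
     {\<xi>. (\<forall>i. (\<lambda>\<zeta>. f \<zeta> $ i) analytic_on {\<xi>}) \<and> (\<forall>j<k. frame f j \<xi> \<noteq> 0)}"

lemma frame_orthogonal: "i \<noteq> j \<Longrightarrow> hdot (frame f i \<xi>) (frame f j \<xi>) = 0"
  unfolding frame_def by (rule gram_schmidt_orthogonal)

lemma frame_eq:
  "frame f n \<xi> = jet f \<xi> n - (\<Sum>j<n. (hdot (frame f j \<xi>) (jet f \<xi> n) /
     hdot (frame f j \<xi>) (frame f j \<xi>)) *s frame f j \<xi>)"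
  unfolding frame_def by (rule gram_schmidt.simps)

lemma frame_0: "frame f 0 \<xi> = f \<xi>"
  by (subst frame_eq) (simp add: jet_def)

lemma jet_in_span: "jet f \<xi> n \<in> vec.span ((\<lambda>j. frame f j \<xi>) ` {..<Suc n})"
  unfolding frame_def by (rule in_span_gram_schmidt)

lemma frame_span_mono:
  "m \<le> n \<Longrightarrow> x \<in> vec.span ((\<lambda>j. frame f j \<xi>) ` {..<m}) \<Longrightarrow>
    x \<in> vec.span ((\<lambda>j. frame f j \<xi>) ` {..<n})"
  by (rule subsetD[OF vec.span_mono]) auto

lemma frame_domain_mono: "\<xi> \<in> frame_domain f n \<Longrightarrow> m \<le> n \<Longrightarrow> \<xi> \<in> frame_domain f m"
  unfolding frame_domain_def by auto

lemma has_wirt_vec_jet: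
  fixes f :: "complex \<Rightarrow> complex ^ 'n"
  assumes "\<And>i. (\<lambda>\<zeta>. f \<zeta> $ i) analytic_on {\<xi>}"
  shows "has_wirt_vec (\<lambda>\<zeta>. jet f \<zeta> n) (jet f \<xi> (Suc n)) 0 \<xi>"
  unfolding has_wirt_vec_def
proof
  fix i
  have "(deriv ^^ n) (\<lambda>\<zeta>. f \<zeta> $ i) analytic_on {\<xi>}"
    by (induction n) (auto intro: assms analytic_deriv)
  hence "(deriv ^^ n) (\<lambda>\<zeta>. f \<zeta> $ i) field_differentiable at \<xi>"
    using analytic_on_imp_differentiable_at by blast
  hence "has_wirt ((deriv ^^ n) (\<lambda>\<zeta>. f \<zeta> $ i)) (deriv ((deriv ^^ n) (\<lambda>\<zeta>. f \<zeta> $ i)) \<xi>) 0 \<xi>"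
    by (intro has_wirt_DERIV) (simp add: DERIV_deriv_iff_field_differentiable)
  thus "has_wirt (\<lambda>\<zeta>. jet f \<zeta> n $ i) (jet f \<xi> (Suc n) $ i) (0 $ i) \<xi>"
    by (simp add: jet_def)
qed

text \<open>Differentiate the Gram-Schmidt formula: \<open>wirt\<close> shifts the jet by one,
  \<open>wirt_bar\<close> annihilates it, and everything else stays in the span of frame vectors of
  the stated indices. The exact coefficients are left to orthogonality.\<close>

lemma frame_differentiable:
  "\<xi> \<in> frame_domain f j \<Longrightarrow> \<exists>A B. has_wirt_vec (frame f j) A B \<xi> \<and>
     A - jet f \<xi> (Suc j) \<in> vec.span ((\<lambda>i. frame f i \<xi>) ` {..<Suc j}) \<and>
     B \<in> vec.span ((\<lambda>i. frame f i \<xi>) ` {..<j})"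
proof (induction j rule: less_induct)
  case (less j)
  let ?S = "\<lambda>m. vec.span ((\<lambda>i. frame f i \<xi>) ` {..<m})"
  have "\<forall>i. \<exists>A B. i < j \<longrightarrow> has_wirt_vec (frame f i) A B \<xi> \<and>
      A - jet f \<xi> (Suc i) \<in> ?S (Suc i) \<and> B \<in> ?S i"
    using less frame_domain_mono by (meson less_imp_le)
  then obtain A B where AB: "\<And>i. i < j \<Longrightarrow> has_wirt_vec (frame f i) (A i) (B i) \<xi>"
    and A: "\<And>i. i < j \<Longrightarrow> A i - jet f \<xi> (Suc i) \<in> ?S (Suc i)"
    and B: "\<And>i. i < j \<Longrightarrow> B i \<in> ?S i"
    by metis
  define c where "c = (\<lambda>i \<zeta>. hdot (frame f i \<zeta>) (jet f \<zeta> j) /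
     hdot (frame f i \<zeta>) (frame f i \<zeta>))"
  have jet: "has_wirt_vec (\<lambda>\<zeta>. jet f \<zeta> j) (jet f \<xi> (Suc j)) 0 \<xi>"
    using less.prems by (intro has_wirt_vec_jet) (simp add: frame_domain_def)
  \<comment> \<open>Only differentiability of the coefficients matters: their derivatives multiply
    frame vectors that lie in the span anyway.\<close>
  have "\<exists>p q. has_wirt (c i) p q \<xi>" if "i < j" for i
    using has_wirt_divide[OF has_wirt_hdot[OF AB[OF that] jet] has_wirt_hdot[OF AB[OF that] AB[OF that]]]
      less.prems that unfolding c_def frame_domain_def by auto
  then obtain p q where pq: "\<And>i. i < j \<Longrightarrow> has_wirt (c i) (p i) (q i) \<xi>"
    by metis
  have "has_wirt_vec (\<lambda>\<zeta>. jet f \<zeta> j - (\<Sum>i<j. c i \<zeta> *s frame f i \<zeta>))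
      (jet f \<xi> (Suc j) - (\<Sum>i<j. c i \<xi> *s A i + p i *s frame f i \<xi>))
      (0 - (\<Sum>i<j. c i \<xi> *s B i + q i *s frame f i \<xi>)) \<xi>"
    by (intro has_wirt_vec_diff jet has_wirt_vec_sum has_wirt_vec_scale pq AB) auto
  also have "(\<lambda>\<zeta>. jet f \<zeta> j - (\<Sum>i<j. c i \<zeta> *s frame f i \<zeta>)) = frame f j"
    by (rule ext) (subst frame_eq, simp add: c_def)
  finally have *: "has_wirt_vec (frame f j)
      (jet f \<xi> (Suc j) - (\<Sum>i<j. c i \<xi> *s A i + p i *s frame f i \<xi>))
      (0 - (\<Sum>i<j. c i \<xi> *s B i + q i *s frame f i \<xi>)) \<xi>" .
  \<comment> \<open>The derivative raises the top index from \<open>i\<close> to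
    \<open>Suc i\<close>, which is still at most \<open>j\<close>.\<close>
  have A': "A i \<in> ?S (Suc j)" if "i < j" for i
  proof -
    have "(A i - jet f \<xi> (Suc i)) + jet f \<xi> (Suc i) \<in> ?S (Suc j)"
      using that by (intro vec.span_add frame_span_mono[OF _ A] frame_span_mono[OF _ jet_in_span]) auto
    thus ?thesis by simp
  qed
  have B': "B i \<in> ?S j" if "i < j" for i
    by (rule frame_span_mono[OF _ B[OF that]]) (use that in simp)
  have "- (\<Sum>i<j. c i \<xi> *s A i + p i *s frame f i \<xi>) \<in> ?S (Suc j)"
    by (intro vec.span_neg vec.span_sum vec.span_add vec.span_scale A' vec.span_base) auto
  moreover have "- (\<Sum>i<j. c i \<xi> *s B i + q i *s frame f i \<xi>) \<in> ?S j"
    by (intro vec.span_neg vec.span_sum vec.span_add vec.span_scale B' vec.span_base) auto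
  ultimately show ?case using * by fastforce
qed

text \<open>In both identities the difference of the two sides lies in the span of frame vectors of lower
  index; differentiating the relations \<open>hdot (frame f i) (frame f j) = 0\<close> shows that it is also
  orthogonal to them.\<close>

lemma frame_derivative:
  assumes \<xi>: "\<xi> \<in> frame_domain f j" and AB: "has_wirt_vec (frame f j) A B \<xi>"
  shows "orth_part (frame f j \<xi>) A = frame f (Suc j) \<xi>"
    and "B = (if j = 0 then 0 else - (hdot (frame f j \<xi>) (frame f j \<xi>) /
       hdot (frame f (j - 1) \<xi>) (frame f (j - 1) \<xi>)) *s frame f (j - 1) \<xi>)"
proof -
  let ?S = "\<lambda>m. vec.span ((\<lambda>i. frame f i \<xi>) ` {..<m})"
  \<comment> \<open>Carries the span memberships from the existential statement over to the given
    \<open>A\<close> and \<open>B\<close>.\<close>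
  have unique: "A' = A \<and> B' = B" if "has_wirt_vec (frame f j) A' B' \<xi>" for A' B'
    using that AB has_wirt_unique unfolding has_wirt_vec_def vec_eq_iff by metis
  have A: "A - jet f \<xi> (Suc j) \<in> ?S (Suc j)" and B: "B \<in> ?S j"
    using frame_differentiable[OF \<xi>] unique by auto
  have "\<exists>C D. has_wirt_vec (frame f i) C D \<xi> \<and>
      C - jet f \<xi> (Suc i) \<in> ?S (Suc i) \<and> D \<in> ?S i" if "i < j" for i
    by (rule frame_differentiable[OF frame_domain_mono[OF \<xi> less_imp_le[OF that]]])
  then obtain C D where C: "\<And>i. i < j \<Longrightarrow> has_wirt_vec (frame f i) (C i) (D i) \<xi>"
    and C': "\<And>i. i < j \<Longrightarrow> C i - jet f \<xi> (Suc i) \<in> ?S (Suc i)"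
    and D: "\<And>i. i < j \<Longrightarrow> D i \<in> ?S i"
    by metis
  have zero: "hdot (frame f i \<xi>) A = 0 \<and> hdot (frame f i \<xi>) B = - hdot (C i) (frame f j \<xi>)"
    if "i < j" for i
  proof -
    have 1: "has_wirt (\<lambda>_. 0) (hdot (frame f i \<xi>) A + hdot (D i) (frame f j \<xi>))
         (hdot (frame f i \<xi>) B + hdot (C i) (frame f j \<xi>)) \<xi>"
      using has_wirt_hdot[OF C[OF that] AB] that by (simp add: frame_orthogonal)
    \<comment> \<open>\<open>D i\<close> involves only indices below \<open>i\<close>, so the
      relation differentiated by \<open>wirt\<close> reduces to
      \<open>hdot (frame f i \<xi>) A = 0\<close>.\<close>
    have "hdot (frame f j \<xi>) (D i) = 0"
      by (rule hdot_span_eq_0[OF D[OF that]]) (use that in \<open>auto simp: frame_orthogonal\<close>)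
    hence "hdot (D i) (frame f j \<xi>) = 0" using hdot_commute_0 by blast
    with has_wirt_unique[OF 1 has_wirt_const[of 0]] show ?thesis
      by (simp add: eq_neg_iff_add_eq_0)
  qed
  have "frame f (Suc j) \<xi> - orth_part (frame f j \<xi>) A = 0"
  proof (rule eq_0_if_in_span_orthogonal)
    have 1: "frame f (Suc j) \<xi> - jet f \<xi> (Suc j) \<in> ?S (Suc j)"
      by (subst frame_eq, unfold diff_conv_add_uminus add_diff_cancel_left' minus_diff_eq)
         (simp del: sum.lessThan_Suc, intro vec.span_neg vec.span_sum vec.span_scale vec.span_base, auto)
    have 2: "(hdot (frame f j \<xi>) A / hdot (frame f j \<xi>) (frame f j \<xi>)) *s frame f j \<xi> \<in> ?S (Suc j)"
      by (intro vec.span_scale vec.span_base) simp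
    have "frame f (Suc j) \<xi> - jet f \<xi> (Suc j) - (A - jet f \<xi> (Suc j)) +
       (hdot (frame f j \<xi>) A / hdot (frame f j \<xi>) (frame f j \<xi>)) *s frame f j \<xi> \<in> ?S (Suc j)"
      by (rule vec.span_add[OF vec.span_diff[OF 1 A] 2])
    thus "frame f (Suc j) \<xi> - orth_part (frame f j \<xi>) A \<in> ?S (Suc j)"
      by (simp add: orth_part_def algebra_simps)
  next
    fix s assume "s \<in> (\<lambda>i. frame f i \<xi>) ` {..<Suc j}"
    then obtain i where i: "i < Suc j" "s = frame f i \<xi>" by auto
    show "hdot s (frame f (Suc j) \<xi> - orth_part (frame f j \<xi>) A) = 0"
    proof (cases "i = j")
      case True
      thus ?thesis using i by (simp add: hdot_simps hdot_orth_part frame_orthogonal)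
    next
      case False
      thus ?thesis using i zero[of i] by (simp add: hdot_simps orth_part_def frame_orthogonal)
    qed
  qed
  thus "orth_part (frame f j \<xi>) A = frame f (Suc j) \<xi>" by simp
  show "B = (if j = 0 then 0 else - (hdot (frame f j \<xi>) (frame f j \<xi>) /
       hdot (frame f (j - 1) \<xi>) (frame f (j - 1) \<xi>)) *s frame f (j - 1) \<xi>)"
  proof (cases "j = 0")
    case True
    thus ?thesis using B by simp
  next
    case False
    have nz: "frame f (j - 1) \<xi> \<noteq> 0" using \<xi> False by (simp add: frame_domain_def)
    let ?r = "hdot (frame f j \<xi>) (frame f j \<xi>) / hdot (frame f (j - 1) \<xi>) (frame f (j - 1) \<xi>)"
    have "B + ?r *s frame f (j - 1) \<xi> = 0"
    proof (rule eq_0_if_in_span_orthogonal)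
      show "B + ?r *s frame f (j - 1) \<xi> \<in> ?S j"
        using False by (intro vec.span_add[OF B] vec.span_scale vec.span_base) auto
    next
      fix s assume "s \<in> (\<lambda>i. frame f i \<xi>) ` {..<j}"
      then obtain i where i: "i < j" "s = frame f i \<xi>" by auto
      \<comment> \<open>Modulo frame vectors of index at most \<open>i\<close>, the derivative
        \<open>C i\<close>, the jet of order \<open>Suc i\<close> and the frame vector of index
        \<open>Suc i\<close> coincide. Paired with \<open>frame f j\<close>, the result is nonzero
        at most for \<open>i = j - 1\<close>, which singles out the one coefficient
        \<open>?r\<close>.\<close>
      have "hdot (frame f j \<xi>) (C i - jet f \<xi> (Suc i)) = 0"
        by (rule hdot_span_eq_0[OF C'[OF i(1)]]) (use i in \<open>auto simp: frame_orthogonal\<close>)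
      moreover have "hdot (frame f j \<xi>) (jet f \<xi> (Suc i) - frame f (Suc i) \<xi>) = 0"
      proof (rule hdot_span_eq_0)
        show "jet f \<xi> (Suc i) - frame f (Suc i) \<xi> \<in> ?S (Suc i)"
          by (subst frame_eq)
             (simp del: sum.lessThan_Suc, intro vec.span_sum vec.span_scale vec.span_base, auto)
      qed (use i in \<open>auto simp: frame_orthogonal\<close>)
      ultimately have "hdot (frame f j \<xi>) (C i) = hdot (frame f j \<xi>) (frame f (Suc i) \<xi>)"
        by (simp add: hdot_simps)
      hence "hdot (C i) (frame f j \<xi>) = hdot (frame f (Suc i) \<xi>) (frame f j \<xi>)"
        by (metis cnj_hdot)
      hence "hdot s B = - hdot (frame f (Suc i) \<xi>) (frame f j \<xi>)"
        using zero[OF i(1)] i by simp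
      moreover have "hdot s (?r *s frame f (j - 1) \<xi>) = hdot (frame f (Suc i) \<xi>) (frame f j \<xi>)"
      proof (cases "Suc i = j")
        case True
        hence "i = j - 1" by simp
        thus ?thesis using i nz True by (simp add: hdot_simps)
      next
        case False
        thus ?thesis using i by (simp add: hdot_simps frame_orthogonal)
      qed
      ultimately show "hdot s (B + ?r *s frame f (j - 1) \<xi>) = 0" by (simp add: hdot_simps)
    qed
    thus ?thesis using False by (simp add: eq_neg_iff_add_eq_0)
  qed
qed

section \<open>Openness of the domains and identification of \<open>V\<close> with the frame\<close>

lemma open_analytic_points:
  fixes f :: "complex \<Rightarrow> complex ^ 'n"
  shows "open {\<xi>. \<forall>i. (\<lambda>\<zeta>. f \<zeta> $ i) analytic_on {\<xi>}}"
proof -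
  have "open {\<xi>. (\<lambda>\<zeta>. f \<zeta> $ i) analytic_on {\<xi>}}" for i
  proof (subst open_subopen, safe)
    fix \<xi> assume "(\<lambda>\<zeta>. f \<zeta> $ i) analytic_on {\<xi>}"
    then obtain T where T: "open T" "\<xi> \<in> T" "(\<lambda>\<zeta>. f \<zeta> $ i) holomorphic_on T"
      by (auto simp: analytic_at)
    hence "T \<subseteq> {\<xi>. (\<lambda>\<zeta>. f \<zeta> $ i) analytic_on {\<xi>}}"
      using holomorphic_on_imp_analytic_at by auto
    with T show "\<exists>T. open T \<and> \<xi> \<in> T \<and> T \<subseteq> {\<xi>. (\<lambda>\<zeta>. f \<zeta> $ i) analytic_on {\<xi>}}" by blast
  qed
  hence "open (\<Inter>i. {\<xi>. (\<lambda>\<zeta>. f \<zeta> $ i) analytic_on {\<xi>}})"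
    by (intro open_INT) auto
  thus ?thesis by (simp add: Collect_all_eq)
qed

text \<open>Each step removes the zeros of \<open>frame f k\<close>, which is continuous on the open
  set reached so far because it is differentiable there.\<close>

lemma open_frame_domain: "open (frame_domain f k)"
proof (induction k)
  case 0
  show ?case using open_analytic_points by (simp add: frame_domain_def)
next
  case (Suc k)
  have "continuous_on (frame_domain f k) (frame f k)"
    using frame_differentiable has_wirt_vec_isCont by (metis continuous_at_imp_continuous_on)
  hence "open (frame_domain f k \<inter> frame f k -` (- {0}))"
    using Suc by (intro continuous_open_preimage) auto
  also have "frame_domain f k \<inter> frame f k -` (- {0}) = frame_domain f (Suc k)"
    by (auto simp: frame_domain_def less_Suc_eq)
  finally show ?case .
qed

lemma V_Suc: "V f (Suc k) = P_plus (V f k)"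
  by (simp add: V_def)

text \<open>The induction hypothesis holds at all points of an open set, so \<open>V f k\<close>
  inherits the derivative of the frame; its part orthogonal to \<open>V f k\<close> is
  \<open>P_plus\<close> on one side and the next frame vector on the other.\<close>

lemma V_eq_frame: "\<xi> \<in> frame_domain f k \<Longrightarrow> V f k \<xi> = frame f k \<xi>"
proof (induction k arbitrary: \<xi>)
  case 0
  show ?case by (simp add: V_def frame_0)
next
  case (Suc k)
  have \<xi>: "\<xi> \<in> frame_domain f k" by (rule frame_domain_mono[OF Suc.prems]) simp
  obtain A B where AB: "has_wirt_vec (frame f k) A B \<xi>" using frame_differentiable[OF \<xi>] by blast
  have "has_wirt_vec (V f k) A B \<xi>"
    by (rule has_wirt_vec_cong_open[OF AB open_frame_domain \<xi>]) (simp add: Suc.IH)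
  thus ?case using frame_derivative(1)[OF \<xi> AB] Suc.IH[OF \<xi>]
    by (simp add: V_Suc P_plus_eq_orth_part has_wirt_vec_imp_wirt_vec)
qed

text \<open>The two conditions are compared one index at a time, since \<open>V f (Suc k)\<close> is
  known to be the frame vector only where all earlier ones are nonzero.\<close>

lemma regular_points_eq_frame_domain: "regular_points f k = frame_domain f (Suc k)"
proof (induction k)
  case 0
  show ?case by (auto simp: regular_points_def frame_domain_def V_def frame_0)
next
  case (Suc k)
  have "regular_points f (Suc k) = regular_points f k \<inter> {\<xi>. V f (Suc k) \<xi> \<noteq> 0}"
    by (auto simp: regular_points_def le_Suc_eq)
  also have "\<dots> = frame_domain f (Suc k) \<inter> {\<xi>. frame f (Suc k) \<xi> \<noteq> 0}"
    using Suc by (auto simp: V_eq_frame)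
  also have "\<dots> = frame_domain f (Suc (Suc k))"
    by (auto simp: frame_domain_def less_Suc_eq)
  finally show ?case .
qed

lemma open_regular_points: "open (regular_points f k)"
  by (simp add: regular_points_eq_frame_domain open_frame_domain)

lemma regular_points_mono: "j \<le> k \<Longrightarrow> regular_points f k \<subseteq> regular_points f j"
  by (auto simp: regular_points_def)

text \<open>The indices reach \<open>Suc k\<close>, so the possibly vanishing next vector is
  included.\<close>

lemma V_orthogonal:
  assumes "\<xi> \<in> regular_points f k" and "i \<le> Suc k" and "j \<le> Suc k" and "i \<noteq> j"
  shows "hdot (V f i \<xi>) (V f j \<xi>) = 0"
  using assms frame_domain_mono[of \<xi> f "Suc k"]
  by (auto simp: regular_points_eq_frame_domain V_eq_frame frame_orthogonal)

text \<open>The frame formulas carried over to \<open>V\<close>. Of \<open>A\<close> only the part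
  orthogonal to \<open>V f k\<close> is recorded, as projectors see nothing else.\<close>

lemma V_derivative:
  assumes "\<xi> \<in> regular_points f k"
  obtains A where "has_wirt_vec (V f k) A (if k = 0 then 0 else
      - (hdot (V f k \<xi>) (V f k \<xi>) / hdot (V f (k - 1) \<xi>) (V f (k - 1) \<xi>)) *s V f (k - 1) \<xi>) \<xi>"
    and "orth_part (V f k \<xi>) A = V f (Suc k) \<xi>"
proof -
  have \<xi>: "\<xi> \<in> frame_domain f (Suc k)" "\<xi> \<in> frame_domain f k" "\<xi> \<in> frame_domain f (k - 1)"
    using assms frame_domain_mono[of \<xi> f "Suc k"] by (auto simp: regular_points_eq_frame_domain)
  obtain A B where AB: "has_wirt_vec (frame f k) A B \<xi>" using frame_differentiable[OF \<xi>(2)] by blast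
  have "has_wirt_vec (V f k) A B \<xi>"
    by (rule has_wirt_vec_cong_open[OF AB open_frame_domain \<xi>(2)]) (simp add: V_eq_frame)
  note V_eq = V_eq_frame[OF \<xi>(1)] V_eq_frame[OF \<xi>(2)] V_eq_frame[OF \<xi>(3)]
  show ?thesis
  proof (rule that)
    show "has_wirt_vec (V f k) A (if k = 0 then 0 else
      - (hdot (V f k \<xi>) (V f k \<xi>) / hdot (V f (k - 1) \<xi>) (V f (k - 1) \<xi>)) *s V f (k - 1) \<xi>) \<xi>"
      unfolding V_eq frame_derivative(2)[OF \<xi>(2) AB, symmetric] by fact
    show "orth_part (V f k \<xi>) A = V f (Suc k) \<xi>"
      unfolding V_eq by (rule frame_derivative(1)[OF \<xi>(2) AB])
  qed
qed

subsection \<open>The Weierstrass integrals\<close>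

lemma cscale_minus_left: "cscale (- c) A = - cscale c A"
  by (simp add: cscale_def vec_eq_iff)

lemma orth_part_0: "orth_part g 0 = 0"
  by (simp add: orth_part_def hdot_simps)

lemma orth_part_orthogonal: "hdot g x = 0 \<Longrightarrow> orth_part g x = x"
  by (simp add: orth_part_def)

text \<open>\<open>cscale c (Q \<zeta>)\<close> is itself an integral, and two integrals differ by a
  constant on a connected open set. Used with \<open>c = - \<i>\<close> for holomorphic and
  \<open>c = \<i>\<close> for antiholomorphic projectors.\<close>

lemma weierstrass_integral_proportional:
  assumes U: "open U" "connected U"
    and Q: "\<And>\<xi>. \<xi> \<in> U \<Longrightarrow> has_wirt_mat Q (wirt_mat Q \<xi>) (wirt_bar_mat Q \<xi>) \<xi>"
    and dX: "\<And>\<xi>. \<xi> \<in> U \<Longrightarrow>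
      dX Q \<xi> = one_form (cscale c (wirt_mat Q \<xi>)) (cscale c (wirt_bar_mat Q \<xi>))"
  shows "\<exists>X. weierstrass_integral X Q U"
    and "weierstrass_integral X Q U \<Longrightarrow> proportional_with c X Q U"
proof -
  have der: "((\<lambda>\<zeta>. cscale c (Q \<zeta>)) has_derivative dX Q \<xi>) (at \<xi>)" if "\<xi> \<in> U" for \<xi>
    using has_wirt_mat_cscale[OF Q[OF that], of c] dX[OF that]
    by (simp add: has_wirt_mat_iff_has_derivative)
  thus "\<exists>X. weierstrass_integral X Q U"
    unfolding weierstrass_integral_def by blast
  assume X: "weierstrass_integral X Q U"
  have "(\<lambda>\<zeta>. X \<zeta> - cscale c (Q \<zeta>)) constant_on U"
  proof -
    have *: "((\<lambda>\<zeta>. X \<zeta> - cscale c (Q \<zeta>)) has_derivative (\<lambda>h. 0)) (at \<xi>)" if "\<xi> \<in> U" for \<xi>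
      using has_derivative_diff[OF X[unfolded weierstrass_integral_def, rule_format, OF that] der[OF that]]
      by simp
    hence "continuous_on U (\<lambda>\<zeta>. X \<zeta> - cscale c (Q \<zeta>))"
      by (meson continuous_at_imp_continuous_on has_derivative_continuous)
    with * show ?thesis
      by (intro has_derivative_zero_connected_constant_on[OF U(2,1), of "{}"])
         (auto intro: has_derivative_at_withinI)
  qed
  then obtain C where "\<And>\<xi>. \<xi> \<in> U \<Longrightarrow> X \<xi> - cscale c (Q \<xi>) = C"
    unfolding constant_on_def by auto
  thus "proportional_with c X Q U"
    unfolding proportional_with_def by (metis add.commute diff_add_cancel)
qed

text \<open>Conjugating the holomorphic components shows that the \<open>wirt\<close> part of
  \<open>g\<close> is 0. Only the terms whose sign the commutator flips survive, so the factor is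
  \<open>\<i>\<close> instead of \<open>- \<i>\<close>.\<close>

lemma antiholomorphic_proj_derivatives:
  fixes Q :: "complex \<Rightarrow> complex ^ 'n ^ 'n"
  assumes U: "open U" "\<xi> \<in> U" and Q: "antiholomorphic_proj Q U"
  shows "has_wirt_mat Q (wirt_mat Q \<xi>) (wirt_bar_mat Q \<xi>) \<xi>"
    and "dX Q \<xi> = one_form (cscale \<i> (wirt_mat Q \<xi>)) (cscale \<i> (wirt_bar_mat Q \<xi>))"
proof -
  obtain g :: "complex \<Rightarrow> complex ^ 'n"
    where g: "\<And>i. (\<lambda>\<xi>. cnj (g \<xi> $ i)) holomorphic_on U"
      and gQ: "\<And>\<xi>. \<xi> \<in> U \<Longrightarrow> g \<xi> \<noteq> 0 \<and> Q \<xi> = rank_one_proj (g \<xi>)"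
    using Q unfolding antiholomorphic_proj_def by blast
  have "has_wirt (\<lambda>\<zeta>. cnj (g \<zeta> $ i)) (deriv (\<lambda>\<zeta>. cnj (g \<zeta> $ i)) \<xi>) 0 \<xi>" for i
    by (rule has_wirt_DERIV, rule holomorphic_derivI[OF g U])
  from has_wirt_cnj[OF this]
  have *: "has_wirt_vec g 0 (\<chi> i. cnj (deriv (\<lambda>\<zeta>. cnj (g \<zeta> $ i)) \<xi>)) \<xi>"
    by (simp add: has_wirt_vec_def)
  note d = dX_rank_one_proj[OF * _ U, of Q, unfolded orth_part_0 outer_simps]
  have d1: "has_wirt_mat Q
     (cscale (1 / hdot (g \<xi>) (g \<xi>)) (0 + outer (g \<xi>) (orth_part (g \<xi>) (\<chi> i. cnj (deriv (\<lambda>\<zeta>. cnj (g \<zeta> $ i)) \<xi>)))))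
     (cscale (1 / hdot (g \<xi>) (g \<xi>)) (outer (orth_part (g \<xi>) (\<chi> i. cnj (deriv (\<lambda>\<zeta>. cnj (g \<zeta> $ i)) \<xi>))) (g \<xi>) + 0)) \<xi>"
    using d(1) gQ U by blast
  show "has_wirt_mat Q (wirt_mat Q \<xi>) (wirt_bar_mat Q \<xi>) \<xi>"
    using d1 has_wirt_mat_imp_wirt_mat[OF d1] by simp
  show "dX Q \<xi> = one_form (cscale \<i> (wirt_mat Q \<xi>)) (cscale \<i> (wirt_bar_mat Q \<xi>))"
    unfolding has_wirt_mat_imp_wirt_mat[OF d1] using d(2) gQ U by (simp add: cscale_simps cscale_minus_left)
qed

section \<open>Ladder forms and the explicit integral\<close>

definition raise_form :: "(complex \<Rightarrow> complex ^ 'n) \<Rightarrow> nat \<Rightarrow> complex \<Rightarrow> complex ^ 'n ^ 'n" where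
  "raise_form f k \<xi> = cscale (1 / hdot (V f k \<xi>) (V f k \<xi>)) (outer (V f (Suc k) \<xi>) (V f k \<xi>))"

text \<open>The Hermitian adjoint of \<open>raise_form\<close>, which sends \<open>V f k\<close> to
  \<open>V f (Suc k)\<close> where \<open>V f k\<close> is nonzero and annihilates the orthogonal
  complement of \<open>V f k\<close>.\<close>

definition lower_form :: "(complex \<Rightarrow> complex ^ 'n) \<Rightarrow> nat \<Rightarrow> complex \<Rightarrow> complex ^ 'n ^ 'n" where
  "lower_form f k \<xi> = cscale (1 / hdot (V f k \<xi>) (V f k \<xi>)) (outer (V f k \<xi>) (V f (Suc k) \<xi>))"

lemma proj_0_derivatives:
  assumes \<xi>: "\<xi> \<in> regular_points f 0"
  shows "has_wirt_mat (proj f 0) (raise_form f 0 \<xi>) (lower_form f 0 \<xi>) \<xi>"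
    and "dX (proj f 0) \<xi> =
      one_form (cscale (- \<i>) (raise_form f 0 \<xi>)) (cscale (- \<i>) (lower_form f 0 \<xi>))"
proof -
  obtain A where A: "has_wirt_vec (V f 0) A 0 \<xi>" "orth_part (V f 0 \<xi>) A = V f (Suc 0) \<xi>"
    using V_derivative[OF \<xi>] by auto
  have "V f 0 \<xi> \<noteq> 0" using \<xi> by (simp add: regular_points_def)
  from dX_rank_one_proj[OF A(1) this open_regular_points \<xi>, of "proj f 0"]
  show "has_wirt_mat (proj f 0) (raise_form f 0 \<xi>) (lower_form f 0 \<xi>) \<xi>"
    and "dX (proj f 0) \<xi> =
      one_form (cscale (- \<i>) (raise_form f 0 \<xi>)) (cscale (- \<i>) (lower_form f 0 \<xi>))"
    by (simp_all add: proj_def A(2) orth_part_0 outer_simps raise_form_def lower_form_def)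
qed

text \<open>The \<open>wirt_bar\<close> derivative of \<open>V f (Suc k)\<close> is a multiple of
  \<open>V f k\<close>, whose factor cancels the norm square in the projector and leaves minus the
  ladder form of index \<open>k\<close>. The commutator flips exactly this sign.\<close>

lemma proj_Suc_derivatives:
  assumes \<xi>: "\<xi> \<in> regular_points f (Suc k)"
  shows "has_wirt_mat (proj f (Suc k)) (raise_form f (Suc k) \<xi> - raise_form f k \<xi>)
      (lower_form f (Suc k) \<xi> - lower_form f k \<xi>) \<xi>"
    and "dX (proj f (Suc k)) \<xi> =
      one_form (cscale (- \<i>) (raise_form f (Suc k) \<xi> + raise_form f k \<xi>))
        (cscale (- \<i>) (lower_form f (Suc k) \<xi> + lower_form f k \<xi>))"
proof -
  let ?n = "\<lambda>j. hdot (V f j \<xi>) (V f j \<xi>)"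
  let ?B = "- (?n (Suc k) / ?n k) *s V f k \<xi>"
  obtain A where A: "has_wirt_vec (V f (Suc k)) A ?B \<xi>"
      "orth_part (V f (Suc k) \<xi>) A = V f (Suc (Suc k)) \<xi>"
    using V_derivative[OF \<xi>] by auto
  have B: "orth_part (V f (Suc k) \<xi>) ?B = ?B"
    by (rule orth_part_orthogonal) (simp only: hdot_simps, simp add: V_orthogonal[OF \<xi>])
  have nz: "V f (Suc k) \<xi> \<noteq> 0" using \<xi> by (simp add: regular_points_def)
  have cnj: "cnj (?n j) = ?n j" for j by (simp add: cnj_hdot)
  have 1: "cscale (1 / ?n (Suc k)) (outer (V f (Suc k) \<xi>) ?B) = - raise_form f k \<xi>"
    "cscale (1 / ?n (Suc k)) (outer ?B (V f (Suc k) \<xi>)) = - lower_form f k \<xi>"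
    using nz cnj by (simp_all add: raise_form_def lower_form_def cscale_def outer_def vec_eq_iff)
  note d = dX_rank_one_proj[OF A(1) nz open_regular_points \<xi>, of "proj f (Suc k)", unfolded A(2) B]
  show "has_wirt_mat (proj f (Suc k)) (raise_form f (Suc k) \<xi> - raise_form f k \<xi>)
      (lower_form f (Suc k) \<xi> - lower_form f k \<xi>) \<xi>"
    using d(1) unfolding cscale_simps(1) 1 by (simp add: proj_def raise_form_def lower_form_def)
  show "dX (proj f (Suc k)) \<xi> =
      one_form (cscale (- \<i>) (raise_form f (Suc k) \<xi> + raise_form f k \<xi>))
        (cscale (- \<i>) (lower_form f (Suc k) \<xi> + lower_form f k \<xi>))"
    using d(2) unfolding cscale_simps(2) 1
    by (simp add: proj_def raise_form_def lower_form_def cscale_simps(1,3))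
qed

text \<open>The derivatives of the projectors are differences of consecutive ladder forms, so the
  sum telescopes.\<close>

lemma has_wirt_mat_sum_proj:
  assumes "\<xi> \<in> regular_points f k"
  shows "has_wirt_mat (\<lambda>\<zeta>. \<Sum>j\<le>k. proj f j \<zeta>) (raise_form f k \<xi>) (lower_form f k \<xi>) \<xi>"
  using assms
proof (induction k)
  case 0
  thus ?case by (simp add: proj_0_derivatives)
next
  case (Suc k)
  hence "\<xi> \<in> regular_points f k" using regular_points_mono[of k "Suc k" f] by auto
  from has_wirt_mat_add[OF Suc.IH[OF this] proj_Suc_derivatives(1)[OF Suc.prems]]
  show ?case by simp
qed

text \<open>Twice the telescoped sum adds twice the ladder form of index \<open>k\<close>, which
  turns the difference in the derivative of the projector into the sum required by
  \<open>dX\<close>.\<close>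

lemma weierstrass_integral_proj_Suc:
  fixes f :: "complex \<Rightarrow> complex ^ 'n"
  shows "weierstrass_integral (\<lambda>\<zeta>. cscale (- \<i>) (proj f (Suc k) \<zeta> + cscale 2 (\<Sum>j\<le>k. proj f j \<zeta>)))
     (proj f (Suc k)) (regular_points f (Suc k))"
  unfolding weierstrass_integral_def
proof
  fix \<xi> assume \<xi>: "\<xi> \<in> regular_points f (Suc k)"
  hence "\<xi> \<in> regular_points f k" using regular_points_mono[of k "Suc k" f] by auto
  from has_wirt_mat_cscale[OF has_wirt_mat_add[OF proj_Suc_derivatives(1)[OF \<xi>]
      has_wirt_mat_cscale[OF has_wirt_mat_sum_proj[OF this], of 2]], of "- \<i>"]
  have "((\<lambda>\<zeta>. cscale (- \<i>) (proj f (Suc k) \<zeta> + cscale 2 (\<Sum>j\<le>k. proj f j \<zeta>))) has_derivative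
      one_form (cscale (- \<i>) (raise_form f (Suc k) \<xi> - raise_form f k \<xi> + cscale 2 (raise_form f k \<xi>)))
       (cscale (- \<i>) (lower_form f (Suc k) \<xi> - lower_form f k \<xi> + cscale 2 (lower_form f k \<xi>)))) (at \<xi>)"
    unfolding has_wirt_mat_iff_has_derivative .
  moreover have "M - N + cscale 2 N = M + N" for M N :: "complex ^ 'n ^ 'n"
    by (simp add: cscale_def vec_eq_iff)
  ultimately show "((\<lambda>\<zeta>. cscale (- \<i>) (proj f (Suc k) \<zeta> + cscale 2 (\<Sum>j\<le>k. proj f j \<zeta>)))
      has_derivative dX (proj f (Suc k)) \<xi>) (at \<xi>)"
    by (simp only: proj_Suc_derivatives(2)[OF \<xi>])
qed

text \<open>If the next vector vanishes, the \<open>wirt\<close> derivative of \<open>V f k\<close>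
  is a multiple of \<open>V f k\<close>. Division by the norm square cancels this multiple, so the
  conjugated components of the quotient are holomorphic.\<close>

lemma antiholomorphic_proj_if_V_Suc_eq_0:
  fixes f :: "complex \<Rightarrow> complex ^ 'n"
  assumes U: "open U" "U \<subseteq> regular_points f k"
    and 0: "\<And>\<xi>. \<xi> \<in> U \<Longrightarrow> V f (Suc k) \<xi> = 0"
  shows "antiholomorphic_proj (proj f k) U"
proof -
  define g where "g \<xi> = (1 / hdot (V f k \<xi>) (V f k \<xi>)) *s V f k \<xi>" for \<xi>
  have nz: "V f k \<xi> \<noteq> 0" if "\<xi> \<in> U" for \<xi>
    using U(2) that by (auto simp: regular_points_def)
  have "\<exists>B. has_wirt_vec g 0 B \<xi>" if \<xi>: "\<xi> \<in> U" for \<xi>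
  proof -
    have reg: "\<xi> \<in> regular_points f k" using U(2) \<xi> by blast
    let ?v = "V f k \<xi>"
    define B where "B = (if k = 0 then 0 else
      - (hdot (V f k \<xi>) (V f k \<xi>) / hdot (V f (k - 1) \<xi>) (V f (k - 1) \<xi>)) *s V f (k - 1) \<xi>)"
    obtain A where A: "has_wirt_vec (V f k) A B \<xi>" "orth_part ?v A = V f (Suc k) \<xi>"
      using V_derivative[OF reg] unfolding B_def by blast
    \<comment> \<open>Hence the \<open>wirt\<close> derivative of the norm square is just
      \<open>hdot ?v A\<close>, the numerator of the multiple to be cancelled.\<close>
    have "hdot ?v B = 0"
      using V_orthogonal[OF reg, of k "k - 1"] unfolding B_def
      by (cases "k = 0") (simp_all add: hdot_simps)
    hence B0: "hdot B ?v = 0" using hdot_commute_0 by blast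
    have A': "A = (hdot ?v A / hdot ?v ?v) *s ?v"
      using A(2) 0[OF \<xi>] by (simp add: orth_part_def)
    have N: "hdot ?v ?v \<noteq> 0" using nz[OF \<xi>] by simp
    from has_wirt_vec_scale[OF has_wirt_divide[OF has_wirt_const[of 1] has_wirt_hdot[OF A(1) A(1)] N] A(1)]
    obtain B' where B': "has_wirt_vec g ((1 / hdot ?v ?v) *s A +
        (0 / hdot ?v ?v - 1 * (hdot ?v A + hdot B ?v) / (hdot ?v ?v)\<^sup>2) *s ?v) B' \<xi>"
      unfolding g_def by blast
    have "(1 / hdot ?v ?v) *s A +
        (0 / hdot ?v ?v - 1 * (hdot ?v A + hdot B ?v) / (hdot ?v ?v)\<^sup>2) *s ?v = 0"
      by (subst A') (simp add: B0 vec_eq_iff power2_eq_square)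
    with B' show ?thesis by auto
  qed
  then obtain B where B: "\<And>\<xi>. \<xi> \<in> U \<Longrightarrow> has_wirt_vec g 0 (B \<xi>) \<xi>" by metis
  have "(\<lambda>\<xi>. cnj (g \<xi> $ i)) holomorphic_on U" for i
  proof (rule holomorphic_onI)
    fix \<xi> assume "\<xi> \<in> U"
    hence "has_wirt (\<lambda>\<zeta>. g \<zeta> $ i) 0 (B \<xi> $ i) \<xi>" using B by (simp add: has_wirt_vec_def)
    from has_wirt_cnj[OF this]
    have "((\<lambda>\<xi>. cnj (g \<xi> $ i)) has_field_derivative cnj (B \<xi> $ i)) (at \<xi>)"
      by (simp add: has_wirt_def has_field_derivative_def)
    thus "(\<lambda>\<xi>. cnj (g \<xi> $ i)) field_differentiable at \<xi> within U"
      using field_differentiable_at_within field_differentiable_def by blast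
  qed
  moreover have "g \<xi> \<noteq> 0 \<and> proj f k \<xi> = rank_one_proj (g \<xi>)" if "\<xi> \<in> U" for \<xi>
    using nz[OF that] by (simp add: g_def proj_def rank_one_proj_scale)
  ultimately show ?thesis unfolding antiholomorphic_proj_def by blast
qed

text \<open>Contrapositive of the nonproportionality claim. The exceptional case is genuine: on
  connected open sets, antiholomorphic projectors have integrals proportional to them with factor
  \<open>\<i>\<close>.\<close>

lemma antiholomorphic_proj_if_proportional:
  fixes f :: "complex \<Rightarrow> complex ^ 'n"
  assumes U: "open U" "U \<subseteq> regular_points f (Suc k)"
    and X: "weierstrass_integral X (proj f (Suc k)) U"
    and Xc: "proportional_with c X (proj f (Suc k)) U"
  shows "antiholomorphic_proj (proj f (Suc k)) U"
proof (rule antiholomorphic_proj_if_V_Suc_eq_0[OF U])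
  fix \<xi> assume "\<xi> \<in> U"
  hence \<xi>: "\<xi> \<in> regular_points f (Suc k)" using U(2) by blast
  let ?v = "V f (Suc k) \<xi>" and ?w = "V f k \<xi>"
  have nz: "?v \<noteq> 0" "?w \<noteq> 0" using \<xi> by (auto simp: regular_points_def)
  obtain C where C: "\<And>\<xi>. \<xi> \<in> U \<Longrightarrow> X \<xi> = cscale c (proj f (Suc k) \<xi>) + C"
    using Xc unfolding proportional_with_def by blast
  \<comment> \<open>\<open>X\<close> is differentiated in two ways, first as an integral and then
    through the assumed proportionality, where the constant \<open>C\<close> contributes 0.\<close>
  have 1: "has_wirt_mat X (cscale (- \<i>) (raise_form f (Suc k) \<xi> + raise_form f k \<xi>))
        (cscale (- \<i>) (lower_form f (Suc k) \<xi> + lower_form f k \<xi>)) \<xi>"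
    using X \<open>\<xi> \<in> U\<close> unfolding has_wirt_mat_iff_has_derivative
      proj_Suc_derivatives(2)[OF \<xi>, symmetric] weierstrass_integral_def by blast
  have 2: "has_wirt_mat X (cscale c (raise_form f (Suc k) \<xi> - raise_form f k \<xi>) + 0)
        (cscale c (lower_form f (Suc k) \<xi> - lower_form f k \<xi>) + 0) \<xi>"
    by (rule has_wirt_mat_cong_open[OF has_wirt_mat_add[OF has_wirt_mat_cscale[OF
          proj_Suc_derivatives(1)[OF \<xi>]] has_wirt_mat_const[of C]] U(1) \<open>\<xi> \<in> U\<close>]) (simp add: C)
  have eq: "cscale (- \<i>) (raise_form f (Suc k) \<xi> + raise_form f k \<xi>) =
      cscale c (raise_form f (Suc k) \<xi> - raise_form f k \<xi>)"
    using trans[OF has_wirt_mat_imp_wirt_mat(1)[OF 1, symmetric] has_wirt_mat_imp_wirt_mat(1)[OF 2]]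
    by (simp only: add_0_right)
  have vec: "cscale a M *v x = a *s (M *v x)" for a and M :: "complex ^ 'n ^ 'n" and x
    by (simp add: cscale_def matrix_vector_mult_def vec_eq_iff sum_distrib_left mult_ac)
  have vw: "hdot ?v ?w = 0" "hdot ?w ?v = 0" using V_orthogonal[OF \<xi>] by auto
  have raise: "raise_form f (Suc k) \<xi> *v ?w = 0" "raise_form f k \<xi> *v ?w = ?v"
    "raise_form f (Suc k) \<xi> *v ?v = V f (Suc (Suc k)) \<xi>" "raise_form f k \<xi> *v ?v = 0"
    using nz by (simp_all add: raise_form_def vec outer_mult_vec vw)
  \<comment> \<open>Evaluation at \<open>V f k\<close> isolates the lower ladder form, which enters
    the two sides with opposite signs; this fixes \<open>c\<close>.\<close>
  have "(- \<i>) *s ?v = c *s (- ?v)"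
    using arg_cong[OF eq, of "\<lambda>M. M *v ?w"]
    by (simp add: vec matrix_vector_mult_add_rdistrib matrix_vector_mult_diff_rdistrib raise)
  hence "(c - \<i>) *s ?v = 0" by (auto simp: vec_eq_iff algebra_simps)
  hence "c = \<i>" using nz by simp
  \<comment> \<open>Evaluation at \<open>V f (Suc k)\<close> isolates the upper ladder form, which
    enters with equal signs; with \<open>c = \<i>\<close> it must annihilate this vector.\<close>
  moreover have "(- \<i>) *s V f (Suc (Suc k)) \<xi> = c *s V f (Suc (Suc k)) \<xi>"
    using arg_cong[OF eq, of "\<lambda>M. M *v ?v"]
    by (simp add: vec matrix_vector_mult_add_rdistrib matrix_vector_mult_diff_rdistrib raise)
  ultimately show "V f (Suc (Suc k)) \<xi> = 0" by (simp add: vec_eq_iff)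
qed

theorem mainTheorem3:
  fixes f :: "complex \<Rightarrow> complex ^ 'n" and k :: nat
  assumes "holomorphic_sphere_solution f"
    and "nonconstant_solution f"
    and "k \<le> CARD('n) - 1"
  shows
    "(k \<noteq> 0 \<longrightarrow> (\<forall>\<xi>\<in>regular_points f k.
        dX (proj f k) \<xi> =
          one_form
            (cscale (- \<i>) (wirt_mat (proj f k) \<xi> +
               cscale (2 / hdot (V f (k - 1) \<xi>) (V f (k - 1) \<xi>))
                      (outer (V f k \<xi>) (V f (k - 1) \<xi>))))
            (cscale (- \<i>) (wirt_bar_mat (proj f k) \<xi> +
               cscale (2 / hdot (V f (k - 1) \<xi>) (V f (k - 1) \<xi>))
                      (outer (V f (k - 1) \<xi>) (V f k \<xi>))))))
     \<and>
     (\<forall>\<xi>\<in>regular_points f 0.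
        dX (proj f 0) \<xi> =
          one_form (cscale (- \<i>) (wirt_mat (proj f 0) \<xi>))
                   (cscale (- \<i>) (wirt_bar_mat (proj f 0) \<xi>)))
     \<and>
     (\<forall>U. open U \<and> connected U \<and> U \<subseteq> regular_points f 0 \<longrightarrow>
        (\<exists>X. weierstrass_integral X (proj f 0) U) \<and>
        (\<forall>X. weierstrass_integral X (proj f 0) U \<longrightarrow> proportional_with (- \<i>) X (proj f 0) U))
     \<and>
     (\<forall>Q U. open U \<and> connected U \<and> antiholomorphic_proj (Q :: complex \<Rightarrow> complex ^ 'n ^ 'n) U \<longrightarrow>
        (\<forall>\<xi>\<in>U. dX Q \<xi> = one_form (cscale \<i> (wirt_mat Q \<xi>)) (cscale \<i> (wirt_bar_mat Q \<xi>))) \<and>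
        (\<exists>X. weierstrass_integral X Q U) \<and>
        (\<forall>X. weierstrass_integral X Q U \<longrightarrow> proportional_with \<i> X Q U))
     \<and>
     (k \<noteq> 0 \<longrightarrow>
        (\<exists>X. weierstrass_integral X (proj f k) (regular_points f k)) \<and>
        (\<forall>U X c. open U \<and> U \<subseteq> regular_points f k \<and> \<not> antiholomorphic_proj (proj f k) U \<and>
           weierstrass_integral X (proj f k) U \<longrightarrow> \<not> proportional_with c X (proj f k) U))"
proof (intro conjI impI)
  assume "k \<noteq> 0"
  then obtain m where k: "k = Suc m" using not0_implies_Suc by blast
  show "\<forall>\<xi>\<in>regular_points f k.
        dX (proj f k) \<xi> =
          one_form
            (cscale (- \<i>) (wirt_mat (proj f k) \<xi> +
               cscale (2 / hdot (V f (k - 1) \<xi>) (V f (k - 1) \<xi>))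
                      (outer (V f k \<xi>) (V f (k - 1) \<xi>))))
            (cscale (- \<i>) (wirt_bar_mat (proj f k) \<xi> +
               cscale (2 / hdot (V f (k - 1) \<xi>) (V f (k - 1) \<xi>))
                      (outer (V f (k - 1) \<xi>) (V f k \<xi>))))"
  proof
    fix \<xi> assume "\<xi> \<in> regular_points f k"
    hence \<xi>: "\<xi> \<in> regular_points f (Suc m)" by (simp add: k)
    \<comment> \<open>Here \<open>M\<close> and \<open>N\<close> are ladder forms of index
      \<open>Suc m\<close> and \<open>m\<close>: the correction term turns the derivative of the
      projector into the coefficient of \<open>dX\<close>.\<close>
    have 1: "M - N + cscale 2 N = M + N" for M N :: "complex ^ 'n ^ 'n"
      by (simp add: cscale_def vec_eq_iff)
    have 2: "cscale (2 / hdot (V f m \<xi>) (V f m \<xi>)) (outer (V f (Suc m) \<xi>) (V f m \<xi>)) =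
        cscale 2 (raise_form f m \<xi>)"
      "cscale (2 / hdot (V f m \<xi>) (V f m \<xi>)) (outer (V f m \<xi>) (V f (Suc m) \<xi>)) =
        cscale 2 (lower_form f m \<xi>)"
      by (simp_all add: raise_form_def lower_form_def cscale_simps)
    show "dX (proj f k) \<xi> =
          one_form
            (cscale (- \<i>) (wirt_mat (proj f k) \<xi> +
               cscale (2 / hdot (V f (k - 1) \<xi>) (V f (k - 1) \<xi>))
                      (outer (V f k \<xi>) (V f (k - 1) \<xi>))))
            (cscale (- \<i>) (wirt_bar_mat (proj f k) \<xi> +
               cscale (2 / hdot (V f (k - 1) \<xi>) (V f (k - 1) \<xi>))
                      (outer (V f (k - 1) \<xi>) (V f k \<xi>))))"
      by (simp only: k diff_Suc_1 proj_Suc_derivatives(2)[OF \<xi>]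
          has_wirt_mat_imp_wirt_mat[OF proj_Suc_derivatives(1)[OF \<xi>]] 1 2)
  qed
next
  have *: "wirt_mat (proj f 0) \<xi> = raise_form f 0 \<xi>" "wirt_bar_mat (proj f 0) \<xi> = lower_form f 0 \<xi>"
    if "\<xi> \<in> regular_points f 0" for \<xi>
    using has_wirt_mat_imp_wirt_mat[OF proj_0_derivatives(1)[OF that]] by auto
  show dX0: "\<forall>\<xi>\<in>regular_points f 0.
        dX (proj f 0) \<xi> =
          one_form (cscale (- \<i>) (wirt_mat (proj f 0) \<xi>))
                   (cscale (- \<i>) (wirt_bar_mat (proj f 0) \<xi>))"
    using proj_0_derivatives(2) * by auto
  show "\<forall>U. open U \<and> connected U \<and> U \<subseteq> regular_points f 0 \<longrightarrow>
        (\<exists>X. weierstrass_integral X (proj f 0) U) \<and>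
        (\<forall>X. weierstrass_integral X (proj f 0) U \<longrightarrow> proportional_with (- \<i>) X (proj f 0) U)"
  proof (intro allI impI, elim conjE)
    fix U assume U: "open U" "connected U" "U \<subseteq> regular_points f 0"
    have "has_wirt_mat (proj f 0) (wirt_mat (proj f 0) \<xi>) (wirt_bar_mat (proj f 0) \<xi>) \<xi>"
      if "\<xi> \<in> U" for \<xi>
      using that U(3) proj_0_derivatives(1) * by (metis subsetD)
    from weierstrass_integral_proportional[OF U(1,2) this, of "- \<i>"] dX0 U(3)
    show "(\<exists>X. weierstrass_integral X (proj f 0) U) \<and>
        (\<forall>X. weierstrass_integral X (proj f 0) U \<longrightarrow> proportional_with (- \<i>) X (proj f 0) U)"
      by blast
  qed
next
  show "\<forall>Q U. open U \<and> connected U \<and> antiholomorphic_proj (Q :: complex \<Rightarrow> complex ^ 'n ^ 'n) U \<longrightarrow>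
        (\<forall>\<xi>\<in>U. dX Q \<xi> = one_form (cscale \<i> (wirt_mat Q \<xi>)) (cscale \<i> (wirt_bar_mat Q \<xi>))) \<and>
        (\<exists>X. weierstrass_integral X Q U) \<and>
        (\<forall>X. weierstrass_integral X Q U \<longrightarrow> proportional_with \<i> X Q U)"
  proof (intro allI impI, elim conjE)
    fix Q :: "complex \<Rightarrow> complex ^ 'n ^ 'n" and U
    assume U: "open U" "connected U" "antiholomorphic_proj Q U"
    note Q = antiholomorphic_proj_derivatives[OF U(1) _ U(3)]
    from weierstrass_integral_proportional[OF U(1,2) Q] Q(2)
    show "(\<forall>\<xi>\<in>U. dX Q \<xi> = one_form (cscale \<i> (wirt_mat Q \<xi>)) (cscale \<i> (wirt_bar_mat Q \<xi>))) \<and>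
        (\<exists>X. weierstrass_integral X Q U) \<and>
        (\<forall>X. weierstrass_integral X Q U \<longrightarrow> proportional_with \<i> X Q U)"
      by blast
  qed
next
  assume "k \<noteq> 0"
  then obtain m where k: "k = Suc m" using not0_implies_Suc by blast
  show "\<exists>X. weierstrass_integral X (proj f k) (regular_points f k)"
    unfolding k using weierstrass_integral_proj_Suc by blast
  show "\<forall>U X c. open U \<and> U \<subseteq> regular_points f k \<and> \<not> antiholomorphic_proj (proj f k) U \<and>
      weierstrass_integral X (proj f k) U \<longrightarrow> \<not> proportional_with c X (proj f k) U"
    unfolding k using antiholomorphic_proj_if_proportional by blast
qed

end
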